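(* Let $G$ be a non-trivial discrete group, let $(u_i)_{i\in\mathbb{N}}$ be a sequence in $Z^2(G,\mathbb{T})$ and let $\alpha_i=\mathrm{Ad}\,\lambda_{u_i}$ be the associated sequence of actions of $G$ on $\mathcal{B}(\ell^2(G))$. If $G$ is either uncountable or non-amenable, then $\odot_i\alpha_i$ does not extend to an action of $G$ on the von Neumann algebra $\otimes_i(\mathcal{B}(\ell^2(G)),\phi_i)$, regardless of the choice of unit vectors $\phi_i\in\ell^2(G)$.
   Context: $Z^2(G,\mathbb{T})$ is the set of normalized 2-cocycles, i.e. maps $u:G\times G\to\mathbb{T}$ (circle group) with $u(x,y)u(xy,z)=u(y,z)u(x,yz)$ and $u(x,e)=u(e,x)=1$. For $u\in Z^2(G,\mathbb{T})$, the left $u$-regular projective unitary representation $\lambda_u$ on $\ell^2(G)$ is $(\lambda_u(x)f)(y)=u(y^{-1},x)f(x^{-1}y)$; it satisfies $\lambda_u(x)\lambda_u(y)=u(x,y)\lambda_u(xy)$. $\mathrm{Ad}(U)(T)=UTU^*$, so $\alpha_{i,g}(T)=\lambda_{u_i}(g)T\lambda_{u_i}(g)^*$. An action of $G$ on a von Neumann algebra $\mathcal{M}$ is a homomorphism $G\to\mathrm{Aut}(\mathcal{M})$. For Hilbert spaces $\mathcal{H}_i$ and unit vectors $\phi_i\in\mathcal{H}_i$, $\bigotimes_i^{\phi}\mathcal{H}_i$ (with $\phi=(\phi_i)$) is the completed inductive limit of the spaces $\mathcal{H}_1\otimes\cdots\otimes\mathcal{H}_n$ under the isometries $\psi\mapsto\psi\otimes\phi_{n+1}$.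 For von Neumann algebras $\mathcal{M}_i\subset\mathcal{B}(\mathcal{H}_i)$, $\odot_i\mathcal{M}_i$ (resp. $\otimes_i(\mathcal{M}_i,\phi_i)$) is the $*$-algebra (resp. von Neumann algebra) on $\bigotimes_i^{\phi}\mathcal{H}_i$ generated by the operators $\otimes_iT_i$ with $T_i\in\mathcal{M}_i$ and $T_i=I_i$ (the identity on $\mathcal{H}_i$) for all but finitely many $i$. Given actions $\alpha_i$ of $G$ on $\mathcal{M}_i$, $\odot_i\alpha_i$ is the action of $G$ on $\odot_i\mathcal{M}_i$ determined, for every finite $J\subset\mathbb{N}$, by $(\otimes_{i\in J}T_i)\otimes(\otimes_{i\notin J}I_i)\mapsto(\otimes_{i\in J}\alpha_{i,g}(T_i))\otimes(\otimes_{i\notin J}I_i)$. *)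

theory Defs
  imports "HOL-Analysis.Analysis"
begin

section \<open>Complex Hilbert spaces\<close>

class complex_vector = real_vector +
  fixes scaleC :: "complex \<Rightarrow> 'a \<Rightarrow> 'a" (infixr "*\<^sub>C" 75)
  assumes scaleC_add_right: "a *\<^sub>C (x + y) = a *\<^sub>C x + a *\<^sub>C y"
    and scaleC_add_left: "(a + b) *\<^sub>C x = a *\<^sub>C x + b *\<^sub>C x"
    and scaleC_scaleC: "a *\<^sub>C b *\<^sub>C x = (a * b) *\<^sub>C x"
    and scaleR_scaleC: "r *\<^sub>R x = complex_of_real r *\<^sub>C x"

text \<open>The complex inner product is linear in the first argument. Definiteness, the norm and the
  topology come from the real inner product, which is its real part.\<close>

class complex_inner = complex_vector + real_inner +
  fixes cinner :: "'a \<Rightarrow> 'a \<Rightarrow> complex"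
  assumes cinner_commute: "cinner x y = cnj (cinner y x)"
    and cinner_add_left: "cinner (x + y) z = cinner x z + cinner y z"
    and cinner_scaleC_left: "cinner (a *\<^sub>C x) y = a * cinner x y"
    and inner_Re_cinner: "inner x y = Re (cinner x y)"

class complex_hilbert = complex_inner + complete_space


section \<open>The Hilbert space of square-summable functions on a discrete set\<close>

typedef 'a ell2 = "{f :: 'a \<Rightarrow> complex. (\<lambda>x. (cmod (f x))\<^sup>2) summable_on UNIV}"
  by (rule exI[of _ "\<lambda>_. 0"]) simp

setup_lifting type_definition_ell2

lemma ell2_add_bound: "(cmod (a + b))\<^sup>2 \<le> 2 * (cmod a)\<^sup>2 + 2 * (cmod b)\<^sup>2"
proof -
  have "(cmod (a + b))\<^sup>2 \<le> (cmod a + cmod b)\<^sup>2"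
    by (intro power_mono norm_triangle_ineq) auto
  also have "\<dots> \<le> 2 * (cmod a)\<^sup>2 + 2 * (cmod b)\<^sup>2"
    using zero_le_power2[of "cmod a - cmod b"] by (simp add: power2_eq_square algebra_simps)
  finally show ?thesis .
qed

lemma ell2_mult_bound: "cmod (a * cnj b) \<le> (cmod a)\<^sup>2 + (cmod b)\<^sup>2"
proof -
  have "2 * (cmod a * cmod b) \<le> (cmod a)\<^sup>2 + (cmod b)\<^sup>2"
    using zero_le_power2[of "cmod a - cmod b"] by (simp add: power2_eq_square algebra_simps)
  moreover have "0 \<le> cmod a * cmod b" by simp
  ultimately show ?thesis by (simp only: norm_mult complex_mod_cnj)
qed

lemma ell2_summable_add:
  fixes f g :: "'a \<Rightarrow> complex"
  assumes "(\<lambda>x. (cmod (f x))\<^sup>2) summable_on UNIV" "(\<lambda>x. (cmod (g x))\<^sup>2) summable_on UNIV"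
  shows "(\<lambda>x. (cmod (f x + g x))\<^sup>2) summable_on UNIV"
proof (rule summable_on_comparison_test)
  show "(\<lambda>x. 2 * (cmod (f x))\<^sup>2 + 2 * (cmod (g x))\<^sup>2) summable_on UNIV"
    by (intro summable_on_add summable_on_cmult_right assms)
qed (auto simp: ell2_add_bound)

lemma ell2_summable_mult:
  fixes f g :: "'a \<Rightarrow> complex"
  assumes "(\<lambda>x. (cmod (f x))\<^sup>2) summable_on UNIV" "(\<lambda>x. (cmod (g x))\<^sup>2) summable_on UNIV"
  shows "(\<lambda>x. f x * cnj (g x)) summable_on UNIV"
proof (rule abs_summable_summable, rule summable_on_comparison_test)
  show "(\<lambda>x. (cmod (f x))\<^sup>2 + (cmod (g x))\<^sup>2) summable_on UNIV"
    by (intro summable_on_add assms)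
qed (use ell2_mult_bound in auto)

lemma ell2_summable_scale:
  fixes f :: "'a \<Rightarrow> complex"
  assumes "(\<lambda>x. (cmod (f x))\<^sup>2) summable_on UNIV"
  shows "(\<lambda>x. (cmod (c * f x))\<^sup>2) summable_on UNIV"
  using summable_on_cmult_right[OF assms, of "(cmod c)\<^sup>2"] by (simp add: norm_mult power_mult_distrib)

instantiation ell2 :: (type) complex_inner
begin

lift_definition zero_ell2 :: "'a ell2" is "\<lambda>_. 0" by simp
lift_definition plus_ell2 :: "'a ell2 \<Rightarrow> 'a ell2 \<Rightarrow> 'a ell2" is "\<lambda>f g x. f x + g x"
  by (rule ell2_summable_add)
lift_definition uminus_ell2 :: "'a ell2 \<Rightarrow> 'a ell2" is "\<lambda>f x. - f x" by simp
lift_definition minus_ell2 :: "'a ell2 \<Rightarrow> 'a ell2 \<Rightarrow> 'a ell2" is "\<lambda>f g x. f x - g x"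
  subgoal for f g using ell2_summable_add[of f "\<lambda>x. - g x"] by simp
  done
lift_definition scaleC_ell2 :: "complex \<Rightarrow> 'a ell2 \<Rightarrow> 'a ell2" is "\<lambda>c f x. c * f x"
  by (rule ell2_summable_scale)
lift_definition scaleR_ell2 :: "real \<Rightarrow> 'a ell2 \<Rightarrow> 'a ell2" is "\<lambda>r f x. complex_of_real r * f x"
  by (rule ell2_summable_scale)
lift_definition cinner_ell2 :: "'a ell2 \<Rightarrow> 'a ell2 \<Rightarrow> complex"
  is "\<lambda>f g. \<Sum>\<^sub>\<infinity>x. f x * cnj (g x)" .

definition inner_ell2 :: "'a ell2 \<Rightarrow> 'a ell2 \<Rightarrow> real" where "inner_ell2 f g = Re (cinner f g)"
definition norm_ell2 :: "'a ell2 \<Rightarrow> real" where "norm_ell2 f = sqrt (inner f f)"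
definition sgn_ell2 :: "'a ell2 \<Rightarrow> 'a ell2" where "sgn_ell2 f = inverse (norm f) *\<^sub>R f"
definition dist_ell2 :: "'a ell2 \<Rightarrow> 'a ell2 \<Rightarrow> real" where "dist_ell2 f g = norm (f - g)"
definition uniformity_ell2 :: "('a ell2 \<times> 'a ell2) filter" where
  "uniformity_ell2 = (INF e\<in>{0<..}. principal {(x, y). dist x y < e})"
definition open_ell2 :: "'a ell2 set \<Rightarrow> bool" where
  "open_ell2 U = (\<forall>x\<in>U. eventually (\<lambda>(x', y). x' = x \<longrightarrow> y \<in> U) uniformity)"

instance
proof
  fix x y z :: "'a ell2" and a b :: complex and r s :: real and U :: "'a ell2 set"
  show "x + y + z = x + (y + z)" by transfer (simp add: add.assoc)
  show "x + y = y + x" by transfer (simp add: add.commute)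
  show "0 + x = x" by transfer simp
  show "- x + x = 0" by transfer simp
  show "x - y = x + - y" by transfer simp
  show "r *\<^sub>R (x + y) = r *\<^sub>R x + r *\<^sub>R y" by transfer (simp add: algebra_simps)
  show "(r + s) *\<^sub>R x = r *\<^sub>R x + s *\<^sub>R x" by transfer (simp add: algebra_simps)
  show "r *\<^sub>R s *\<^sub>R x = (r * s) *\<^sub>R x" by transfer (simp add: mult.assoc)
  show "1 *\<^sub>R x = x" by transfer simp
  show "a *\<^sub>C (x + y) = a *\<^sub>C x + a *\<^sub>C y" by transfer (simp add: algebra_simps)
  show "(a + b) *\<^sub>C x = a *\<^sub>C x + b *\<^sub>C x" by transfer (simp add: algebra_simps)
  show "a *\<^sub>C b *\<^sub>C x = (a * b) *\<^sub>C x" by transfer (simp add: mult.assoc)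
  show "r *\<^sub>R x = complex_of_real r *\<^sub>C x" by transfer simp
  show comm: "cinner x y = cnj (cinner y x)" for x y :: "'a ell2"
    by transfer (simp add: infsum_cnj[symmetric] mult.commute del: infsum_cnj)
  show add: "cinner (x + y) z = cinner x z + cinner y z"
    by transfer (simp add: ring_distribs infsum_add ell2_summable_mult)
  show scale: "cinner (a *\<^sub>C x) y = a * cinner x y" for a
    by transfer (simp add: mult.assoc infsum_cmult_right ell2_summable_mult)
  show "inner x y = Re (cinner x y)" by (rule inner_ell2_def)
  show "inner x y = inner y x" unfolding inner_ell2_def by (subst comm) simp
  show "inner (x + y) z = inner x z + inner y z" unfolding inner_ell2_def by (simp add: add)
  have "r *\<^sub>R x = complex_of_real r *\<^sub>C x" by transfer simp
  then show "inner (r *\<^sub>R x) y = r * inner x y" unfolding inner_ell2_def by (simp add: scale)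
  have eq: "inner x x = (\<Sum>\<^sub>\<infinity>i. (cmod (Rep_ell2 x i))\<^sup>2)"
  proof -
    have "cinner x x = (\<Sum>\<^sub>\<infinity>i. complex_of_real ((cmod (Rep_ell2 x i))\<^sup>2))"
      by (simp add: cinner_ell2.rep_eq complex_norm_square[symmetric] del: of_real_power)
    also have "\<dots> = complex_of_real (\<Sum>\<^sub>\<infinity>i. (cmod (Rep_ell2 x i))\<^sup>2)"
      using has_sum_of_real[OF has_sum_infsum, of "\<lambda>i. (cmod (Rep_ell2 x i))\<^sup>2" UNIV] Rep_ell2[of x]
      by (intro infsumI) simp
    finally show ?thesis by (simp add: inner_ell2_def)
  qed
  show "0 \<le> inner x x" unfolding eq by (intro infsum_nonneg) simp
  show "inner x x = 0 \<longleftrightarrow> x = 0"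
  proof
    assume "inner x x = 0"
    then have "Rep_ell2 x i = 0" for i
      using nonneg_infsum_le_0D[of "\<lambda>i. (cmod (Rep_ell2 x i))\<^sup>2" UNIV i] Rep_ell2[of x] by (simp add: eq)
    then show "x = 0" by transfer auto
  next
    assume "x = 0" then show "inner x x = 0" unfolding eq by (simp add: zero_ell2.rep_eq)
  qed
  show "norm x = sqrt (inner x x)" by (rule norm_ell2_def)
  show "sgn x = inverse (norm x) *\<^sub>R x" by (rule sgn_ell2_def)
  show "dist x y = norm (x - y)" by (rule dist_ell2_def)
  show "uniformity = (INF e\<in>{0<..}. principal {(x :: 'a ell2, y). dist x y < e})"
    by (rule uniformity_ell2_def)
  show "open U = (\<forall>x\<in>U. eventually (\<lambda>(x', y). x' = x \<longrightarrow> y \<in> U) uniformity)"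
    by (rule open_ell2_def)
qed

end

lemma Rep_ell2_summable: "(\<lambda>i. (cmod (Rep_ell2 x i))\<^sup>2) summable_on UNIV"
  using Rep_ell2[of x] by simp

lemma cinner_ell2_self: "cinner x x = complex_of_real (\<Sum>\<^sub>\<infinity>i. (cmod (Rep_ell2 x i))\<^sup>2)"
proof -
  have "cinner x x = (\<Sum>\<^sub>\<infinity>i. complex_of_real ((cmod (Rep_ell2 x i))\<^sup>2))"
    by (simp add: cinner_ell2.rep_eq complex_norm_square[symmetric] del: of_real_power)
  also have "\<dots> = complex_of_real (\<Sum>\<^sub>\<infinity>i. (cmod (Rep_ell2 x i))\<^sup>2)"
    using has_sum_of_real[OF has_sum_infsum[OF Rep_ell2_summable[of x]]]
    by (intro infsumI) simp
  finally show ?thesis .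
qed

lemma norm_ell2_squared: "(norm x)\<^sup>2 = (\<Sum>\<^sub>\<infinity>i. (cmod (Rep_ell2 x i))\<^sup>2)"
  by (simp add: power2_norm_eq_inner inner_Re_cinner cinner_ell2_self)

lemma sum_le_norm_ell2: "finite F \<Longrightarrow> (\<Sum>i\<in>F. (cmod (Rep_ell2 x i))\<^sup>2) \<le> (norm x)\<^sup>2"
  unfolding norm_ell2_squared by (rule finite_sum_le_infsum) (auto intro: Rep_ell2_summable)

lemma norm_ell2_le:
  assumes "0 \<le> C" and "\<And>F. finite F \<Longrightarrow> (\<Sum>i\<in>F. (cmod (Rep_ell2 x i))\<^sup>2) \<le> C\<^sup>2"
  shows "norm x \<le> C"
proof -
  have "(norm x)\<^sup>2 \<le> C\<^sup>2"
    unfolding norm_ell2_squared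
    by (rule infsum_le_finite_sums) (auto intro: Rep_ell2_summable assms)
  then show ?thesis using assms(1) by (rule power2_le_imp_le)
qed

lemma cmod_Rep_ell2_le: "cmod (Rep_ell2 x i) \<le> norm x"
  using sum_le_norm_ell2[of "{i}" x] by (auto intro: power2_le_imp_le)

instance ell2 :: (type) complex_hilbert
proof
  fix X :: "nat \<Rightarrow> 'a ell2"
  assume X: "Cauchy X"
  have conv: "convergent (\<lambda>n. Rep_ell2 (X n) i)" for i
  proof -
    have "Cauchy (\<lambda>n. Rep_ell2 (X n) i)"
    proof (rule metric_CauchyI)
      fix e :: real assume "e > 0"
      then obtain M where M: "\<forall>m\<ge>M. \<forall>n\<ge>M. dist (X m) (X n) < e"
        using X by (auto simp: Cauchy_def)
      have "dist (Rep_ell2 (X m) i) (Rep_ell2 (X n) i) \<le> dist (X m) (X n)" for m n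
        using cmod_Rep_ell2_le[of "X m - X n" i] by (simp add: dist_norm minus_ell2.rep_eq)
      then show "\<exists>M. \<forall>m\<ge>M. \<forall>n\<ge>M. dist (Rep_ell2 (X m) i) (Rep_ell2 (X n) i) < e"
        using M le_less_trans by blast
    qed
    then show ?thesis by (rule Cauchy_convergent)
  qed
  define f where "f i = lim (\<lambda>n. Rep_ell2 (X n) i)" for i
  have lim: "(\<lambda>n. Rep_ell2 (X n) i) \<longlonglongrightarrow> f i" for i
    using conv convergent_LIMSEQ_iff unfolding f_def by blast
  have fin: "(\<Sum>i\<in>F. (cmod (Rep_ell2 (X m) i - f i))\<^sup>2) \<le> C\<^sup>2"
    if "finite F" "\<And>n. n \<ge> M \<Longrightarrow> norm (X m - X n) \<le> C" for F m M C
  proof (rule LIMSEQ_le_const2)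
    show "(\<lambda>n. \<Sum>i\<in>F. (cmod (Rep_ell2 (X m) i - Rep_ell2 (X n) i))\<^sup>2)
        \<longlonglongrightarrow> (\<Sum>i\<in>F. (cmod (Rep_ell2 (X m) i - f i))\<^sup>2)"
      by (intro tendsto_intros lim)
    have "(\<Sum>i\<in>F. (cmod (Rep_ell2 (X m) i - Rep_ell2 (X n) i))\<^sup>2) \<le> C\<^sup>2" if "n \<ge> M" for n
    proof -
      have "(\<Sum>i\<in>F. (cmod (Rep_ell2 (X m) i - Rep_ell2 (X n) i))\<^sup>2) \<le> (norm (X m - X n))\<^sup>2"
        using sum_le_norm_ell2[OF \<open>finite F\<close>, of "X m - X n"] by (simp add: minus_ell2.rep_eq)
      also have "\<dots> \<le> C\<^sup>2" using \<open>n \<ge> M\<close> that(1) \<open>\<And>n. n \<ge> M \<Longrightarrow> norm (X m - X n) \<le> C\<close>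
        by (intro power_mono) auto
      finally show ?thesis .
    qed
    then show "\<exists>N. \<forall>n\<ge>N. (\<Sum>i\<in>F. (cmod (Rep_ell2 (X m) i - Rep_ell2 (X n) i))\<^sup>2) \<le> C\<^sup>2" by blast
  qed
  obtain M where M: "\<And>m n. m \<ge> M \<Longrightarrow> n \<ge> M \<Longrightarrow> dist (X m) (X n) < 1"
    using X by (metis Cauchy_def zero_less_one)
  have diff: "(\<lambda>i. (cmod (Rep_ell2 (X M) i - f i))\<^sup>2) summable_on UNIV"
  proof (rule nonneg_bdd_above_summable_on)
    show "bdd_above (sum (\<lambda>i. (cmod (Rep_ell2 (X M) i - f i))\<^sup>2) ` {F. F \<subseteq> UNIV \<and> finite F})"
      using fin[of _ M M 1] M by (intro bdd_aboveI2[of _ _ 1]) (auto simp: dist_norm less_imp_le)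
  qed auto
  have summ: "(\<lambda>i. (cmod (f i))\<^sup>2) summable_on UNIV"
  proof -
    have "(\<lambda>i. (cmod (- 1 * (Rep_ell2 (X M) i - f i)))\<^sup>2) summable_on UNIV"
      by (rule ell2_summable_scale[OF diff])
    from ell2_summable_add[OF Rep_ell2_summable[of "X M"] this] show ?thesis by simp
  qed
  define L where "L = Abs_ell2 f"
  have L: "Rep_ell2 L = f" unfolding L_def using summ by (simp add: Abs_ell2_inverse)
  have "X \<longlonglongrightarrow> L"
  proof (rule metric_LIMSEQ_I)
    fix e :: real assume "e > 0"
    then obtain N where N: "\<And>m n. m \<ge> N \<Longrightarrow> n \<ge> N \<Longrightarrow> dist (X m) (X n) < e / 2"
      using X by (metis Cauchy_def half_gt_zero)
    have "dist (X m) L < e" if "m \<ge> N" for m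
    proof -
      have "norm (X m - L) \<le> e / 2"
        using fin[of _ N m "e / 2"] N[OF that] \<open>e > 0\<close>
        by (intro norm_ell2_le) (auto simp: L minus_ell2.rep_eq dist_norm less_imp_le)
      then show ?thesis using \<open>e > 0\<close> by (simp add: dist_norm)
    qed
    then show "\<exists>N. \<forall>n\<ge>N. dist (X n) L < e" by blast
  qed
  then show "convergent X" by (rule convergentI)
qed


section \<open>Bounded operators and von Neumann algebras\<close>

definition bounded_ops :: "('h::complex_hilbert \<Rightarrow> 'h) set" where
  "bounded_ops = {T. bounded_linear T \<and> (\<forall>c x. T (c *\<^sub>C x) = c *\<^sub>C T x)}"

definition cadjoint :: "('h::complex_hilbert \<Rightarrow> 'h) \<Rightarrow> 'h \<Rightarrow> 'h" where
  "cadjoint T = (THE S. \<forall>x y. cinner (T x) y = cinner x (S y))"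

definition Ad :: "('h::complex_hilbert \<Rightarrow> 'h) \<Rightarrow> ('h \<Rightarrow> 'h) \<Rightarrow> 'h \<Rightarrow> 'h" where
  "Ad U T = U \<circ> T \<circ> cadjoint U"

definition star_algebra :: "('h::complex_hilbert \<Rightarrow> 'h) set \<Rightarrow> bool" where
  "star_algebra A \<longleftrightarrow> A \<subseteq> bounded_ops \<and> (\<lambda>_. 0) \<in> A \<and>
     (\<forall>S\<in>A. \<forall>T\<in>A. (\<lambda>x. S x + T x) \<in> A \<and> S \<circ> T \<in> A) \<and>
     (\<forall>c. \<forall>T\<in>A. (\<lambda>x. c *\<^sub>C T x) \<in> A) \<and>
     (\<forall>T\<in>A. cadjoint T \<in> A)"

definition commutant :: "('h::complex_hilbert \<Rightarrow> 'h) set \<Rightarrow> ('h \<Rightarrow> 'h) set" where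
  "commutant A = {S \<in> bounded_ops. \<forall>T\<in>A. S \<circ> T = T \<circ> S}"

definition von_neumann_algebra :: "('h::complex_hilbert \<Rightarrow> 'h) set \<Rightarrow> bool" where
  "von_neumann_algebra M \<longleftrightarrow> star_algebra M \<and> commutant (commutant M) = M"

definition generated_star_algebra :: "('h::complex_hilbert \<Rightarrow> 'h) set \<Rightarrow> ('h \<Rightarrow> 'h) set" where
  "generated_star_algebra S = \<Inter>{A. star_algebra A \<and> S \<subseteq> A}"

definition generated_von_neumann_algebra :: "('h::complex_hilbert \<Rightarrow> 'h) set \<Rightarrow> ('h \<Rightarrow> 'h) set" where
  "generated_von_neumann_algebra S = \<Inter>{M. von_neumann_algebra M \<and> S \<subseteq> M}"

definition star_automorphism ::
    "('h::complex_hilbert \<Rightarrow> 'h) set \<Rightarrow> (('h \<Rightarrow> 'h) \<Rightarrow> ('h \<Rightarrow> 'h)) \<Rightarrow> bool" where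
  "star_automorphism A \<theta> \<longleftrightarrow> bij_betw \<theta> A A \<and>
     (\<forall>S\<in>A. \<forall>T\<in>A. \<theta> (\<lambda>x. S x + T x) = (\<lambda>x. \<theta> S x + \<theta> T x) \<and> \<theta> (S \<circ> T) = \<theta> S \<circ> \<theta> T) \<and>
     (\<forall>c. \<forall>T\<in>A. \<theta> (\<lambda>x. c *\<^sub>C T x) = (\<lambda>x. c *\<^sub>C \<theta> T x)) \<and>
     (\<forall>T\<in>A. \<theta> (cadjoint T) = cadjoint (\<theta> T))"

text \<open>Groups are written additively, following the library class for not necessarily
  commutative groups: \<open>x + y\<close> is the product, \<open>0\<close> the identity, \<open>- x\<close> the inverse.\<close>

definition group_action ::
    "('h::complex_hilbert \<Rightarrow> 'h) set \<Rightarrow> ('g::group_add \<Rightarrow> ('h \<Rightarrow> 'h) \<Rightarrow> ('h \<Rightarrow> 'h)) \<Rightarrow> bool" where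
  "group_action A \<beta> \<longleftrightarrow> (\<forall>g. star_automorphism A (\<beta> g)) \<and>
     (\<forall>g h. \<forall>T\<in>A. \<beta> (g + h) T = \<beta> g (\<beta> h T))"


section \<open>Infinite tensor products\<close>

text \<open>The \<open>n\<close>-fold Hilbert tensor power of the space of square-summable functions on \<open>'g\<close> is the
  space of square-summable functions on \<open>n\<close>-tuples, realised as the functions on lists that vanish
  off the lists of length \<open>n\<close>. Tensor factors are numbered from \<open>0\<close>.\<close>

definition tensor_power :: "nat \<Rightarrow> 'g list ell2 set" where
  "tensor_power n = {\<psi>. \<forall>xs. length xs \<noteq> n \<longrightarrow> Rep_ell2 \<psi> xs = 0}"

definition elementary_tensor :: "nat \<Rightarrow> (nat \<Rightarrow> 'g ell2) \<Rightarrow> 'g list ell2" where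
  "elementary_tensor n \<xi> =
     Abs_ell2 (\<lambda>xs. if length xs = n then \<Prod>i<n. Rep_ell2 (\<xi> i) (xs ! i) else 0)"

definition tensor_right :: "'g list ell2 \<Rightarrow> 'g ell2 \<Rightarrow> 'g list ell2" where
  "tensor_right \<psi> \<eta> =
     Abs_ell2 (\<lambda>xs. if xs = [] then 0 else Rep_ell2 \<psi> (butlast xs) * Rep_ell2 \<eta> (last xs))"

text \<open>The Hilbert space \<open>'k\<close> with the maps \<open>J n\<close> is the completed inductive limit of the tensor
  powers under \<open>\<psi> \<mapsto> \<psi> \<otimes> \<phi> n\<close>: the \<open>J n\<close> are compatible linear isometries and
  the union of their ranges is dense. This determines \<open>'k\<close> and \<open>J\<close> up to a unique unitary
  intertwining the maps \<open>J n\<close>.\<close>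

definition infinite_tensor_product ::
    "(nat \<Rightarrow> 'g ell2) \<Rightarrow> (nat \<Rightarrow> 'g list ell2 \<Rightarrow> 'k::complex_hilbert) \<Rightarrow> bool" where
  "infinite_tensor_product \<phi> J \<longleftrightarrow>
     (\<forall>n. \<forall>\<psi>\<in>tensor_power n. \<forall>\<psi>'\<in>tensor_power n. J n (\<psi> + \<psi>') = J n \<psi> + J n \<psi>') \<and>
     (\<forall>n c. \<forall>\<psi>\<in>tensor_power n. J n (c *\<^sub>C \<psi>) = c *\<^sub>C J n \<psi>) \<and>
     (\<forall>n. \<forall>\<psi>\<in>tensor_power n. norm (J n \<psi>) = norm \<psi>) \<and>
     (\<forall>n. \<forall>\<psi>\<in>tensor_power n. J (Suc n) (tensor_right \<psi> (\<phi> n)) = J n \<psi>) \<and>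
     closure (\<Union>n. J n ` tensor_power n) = UNIV"

text \<open>\<open>X\<close> is the operator \<open>\<Otimes>\<^sub>i T i\<close>, where \<open>T i\<close> is the identity for all but finitely many \<open>i\<close>.\<close>

definition is_tensor_op ::
    "(nat \<Rightarrow> 'g list ell2 \<Rightarrow> 'k::complex_hilbert) \<Rightarrow> (nat \<Rightarrow> 'g ell2 \<Rightarrow> 'g ell2) \<Rightarrow> ('k \<Rightarrow> 'k) \<Rightarrow> bool"
  where
  "is_tensor_op J T X \<longleftrightarrow> X \<in> bounded_ops \<and> finite {i. T i \<noteq> id} \<and>
     (\<forall>n \<xi>. (\<forall>i\<ge>n. T i = id) \<longrightarrow>
        X (J n (elementary_tensor n \<xi>)) = J n (elementary_tensor n (\<lambda>i. T i (\<xi> i))))"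

definition tensor_ops ::
    "(nat \<Rightarrow> 'g list ell2 \<Rightarrow> 'k::complex_hilbert) \<Rightarrow> (nat \<Rightarrow> ('g ell2 \<Rightarrow> 'g ell2) set) \<Rightarrow> ('k \<Rightarrow> 'k) set"
  where
  "tensor_ops J M = {X. \<exists>T. (\<forall>i. T i \<in> M i) \<and> is_tensor_op J T X}"

definition algebraic_tensor_product where
  "algebraic_tensor_product J M = generated_star_algebra (tensor_ops J M)"

definition von_neumann_tensor_product where
  "von_neumann_tensor_product J M = generated_von_neumann_algebra (tensor_ops J M)"

text \<open>\<open>\<beta>\<close>, restricted to the algebraic tensor product of the \<open>M i\<close>, is the product action of the
  actions \<open>\<alpha> i\<close>.\<close>

definition is_product_action ::
    "(nat \<Rightarrow> 'g list ell2 \<Rightarrow> 'k::complex_hilbert) \<Rightarrow> (nat \<Rightarrow> ('g ell2 \<Rightarrow> 'g ell2) set) \<Rightarrow>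
     (nat \<Rightarrow> 'g \<Rightarrow> ('g ell2 \<Rightarrow> 'g ell2) \<Rightarrow> ('g ell2 \<Rightarrow> 'g ell2)) \<Rightarrow>
     ('g::group_add \<Rightarrow> ('k \<Rightarrow> 'k) \<Rightarrow> ('k \<Rightarrow> 'k)) \<Rightarrow> bool" where
  "is_product_action J M \<alpha> \<beta> \<longleftrightarrow> group_action (algebraic_tensor_product J M) \<beta> \<and>
     (\<forall>g T X. (\<forall>i. T i \<in> M i) \<longrightarrow> is_tensor_op J T X \<longrightarrow>
        is_tensor_op J (\<lambda>i. \<alpha> i g (T i)) (\<beta> g X))"


section \<open>Projective regular representations and amenability\<close>

definition cocycles :: "('g::group_add \<Rightarrow> 'g \<Rightarrow> complex) set" where
  "cocycles = {u. (\<forall>x y. cmod (u x y) = 1) \<and>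
     (\<forall>x y z. u x y * u (x + y) z = u y z * u x (y + z)) \<and>
     (\<forall>x. u x 0 = 1 \<and> u 0 x = 1)}"

definition regular_rep :: "('g::group_add \<Rightarrow> 'g \<Rightarrow> complex) \<Rightarrow> 'g \<Rightarrow> 'g ell2 \<Rightarrow> 'g ell2" where
  "regular_rep u x f = Abs_ell2 (\<lambda>y. u (- y) x * Rep_ell2 f (- x + y))"

lemma Rep_regular_rep:
  assumes "u \<in> cocycles"
  shows "Rep_ell2 (regular_rep u x f) y = u (- y) x * Rep_ell2 f (- x + y)"
proof -
  have "bij (\<lambda>y. - x + y)"
    by (rule bij_betwI[where g = "\<lambda>y. x + y"]) (auto simp flip: add.assoc)
  then have "(\<lambda>y. (cmod (Rep_ell2 f (- x + y)))\<^sup>2) summable_on UNIV"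
    using summable_on_reindex_bij_betw[of "\<lambda>y. - x + y" UNIV UNIV "\<lambda>y. (cmod (Rep_ell2 f y))\<^sup>2"]
      Rep_ell2_summable[of f] by simp
  then have "(\<lambda>y. (cmod (u (- y) x * Rep_ell2 f (- x + y)))\<^sup>2) summable_on UNIV"
    using assms by (simp add: cocycles_def norm_mult)
  then show ?thesis by (simp add: regular_rep_def Abs_ell2_inverse)
qed

text \<open>Existence of a left-invariant mean on the bounded functions. \<open>m\<close> is unconstrained on
  unbounded functions.\<close>

definition amenable :: "'g::group_add itself \<Rightarrow> bool" where
  "amenable _ \<longleftrightarrow> (\<exists>m :: ('g \<Rightarrow> real) \<Rightarrow> real.
     (\<forall>f h. bounded (range f) \<longrightarrow> bounded (range h) \<longrightarrow> m (\<lambda>x. f x + h x) = m f + m h) \<and>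
     (\<forall>c f. bounded (range f) \<longrightarrow> m (\<lambda>x. c * f x) = c * m f) \<and>
     (\<forall>f. bounded (range f) \<longrightarrow> (\<forall>x. 0 \<le> f x) \<longrightarrow> 0 \<le> m f) \<and>
     m (\<lambda>_. 1) = 1 \<and>
     (\<forall>g f. bounded (range f) \<longrightarrow> m (\<lambda>x. f (- g + x)) = m f))"


section \<open>Existence of infinite tensor products\<close>

text \<open>For every sequence of unit vectors the predicate \<open>infinite_tensor_product\<close> is satisfied by
  some Hilbert space: with orthonormal bases \<open>b i\<close> such that \<open>b i 0 = \<phi> i\<close>, take the
  square-summable functions on the finitely supported sequences in \<open>'g\<close>.\<close>

context complex_inner begin

lemma cinner_add_right: "cinner z (x + y) = cinner z x + cinner z y"
  by (metis cinner_add_left cinner_commute complex_cnj_add)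

lemma cinner_scaleC_right: "cinner x (a *\<^sub>C y) = cnj a * cinner x y"
  by (metis cinner_scaleC_left cinner_commute complex_cnj_mult)

end

lemma scaleC_minus1: "(-1) *\<^sub>C x = - (x :: 'a::complex_vector)"
  using scaleR_scaleC[of "-1" x] by simp

lemma scaleC_one: "1 *\<^sub>C x = (x :: 'a::complex_vector)"
  using scaleR_scaleC[of 1 x] by simp

lemma cinner_minus_left: "cinner (- x) y = - cinner (x :: 'a::complex_inner) y"
  by (metis scaleC_minus1 cinner_scaleC_left mult_minus1)

lemma cinner_diff_left: "cinner (x - y) z = cinner x z - cinner (y :: 'a::complex_inner) z"
  using cinner_add_left[of x "- y" z] by (simp add: cinner_minus_left)

lemma cinner_diff_right: "cinner z (x - y) = cinner z x - cinner (z :: 'a::complex_inner) y"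
  by (metis cinner_diff_left cinner_commute complex_cnj_diff)

lemma cinner_self: "cinner x x = complex_of_real ((norm (x :: 'a::complex_inner))\<^sup>2)"
proof -
  have "Im (cinner x x) = 0" using cinner_commute[of x x] by (simp add: complex_eq_iff)
  then show ?thesis by (simp add: complex_eq_iff power2_norm_eq_inner inner_Re_cinner)
qed

lemma norm_scaleC: "norm (c *\<^sub>C x) = cmod c * norm (x :: 'a::complex_inner)"
proof -
  have "complex_of_real ((norm (c *\<^sub>C x))\<^sup>2) = complex_of_real ((cmod c * norm x)\<^sup>2)"
    unfolding cinner_self[symmetric] cinner_scaleC_left cinner_scaleC_right
    using complex_norm_square[of c] by (simp add: cinner_self power_mult_distrib mult_ac)
  then have "(norm (c *\<^sub>C x))\<^sup>2 = (cmod c * norm x)\<^sup>2" by (simp only: of_real_eq_iff)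
  then show ?thesis by (rule power2_eq_imp_eq) auto
qed

lemma cmod_cinner_le: "cmod (cinner x y) \<le> norm x * norm (y :: 'a::complex_inner)"
proof (cases "cinner x y = 0")
  case False
  define c where "c = cnj (cinner x y) / cmod (cinner x y)"
  have c: "cmod c = 1" using False by (simp add: c_def norm_divide)
  have "cinner (c *\<^sub>C x) y = complex_of_real (cmod (cinner x y))"
    using False complex_norm_square[of "cinner x y"]
    by (simp add: cinner_scaleC_left c_def field_simps power2_eq_square)
  then have "cmod (cinner x y) = inner (c *\<^sub>C x) y" by (simp add: inner_Re_cinner)
  also have "\<dots> \<le> norm (c *\<^sub>C x) * norm y" by (rule norm_cauchy_schwarz)
  finally show ?thesis by (simp add: norm_scaleC c)
qed simp

lemma cinner_ell2_has_sum:
  "((\<lambda>i. Rep_ell2 x i * cnj (Rep_ell2 y i)) has_sum cinner x y) UNIV"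
  unfolding cinner_ell2.rep_eq
  by (intro has_sum_infsum ell2_summable_mult Rep_ell2_summable)

lemma norm_ell2_has_sum: "((\<lambda>i. (cmod (Rep_ell2 x i))\<^sup>2) has_sum (norm x)\<^sup>2) UNIV"
  unfolding norm_ell2_squared by (intro has_sum_infsum Rep_ell2_summable)

lemma Rep_Abs_ell2: "(\<lambda>i. (cmod (f i))\<^sup>2) summable_on UNIV \<Longrightarrow> Rep_ell2 (Abs_ell2 f) = f"
  by (simp add: Abs_ell2_inverse)

lemma has_sum_snoc:
  fixes f :: "'g list \<Rightarrow> 'a :: {topological_comm_monoid_add, t2_space}"
  assumes "f [] = 0"
  shows "(f has_sum S) UNIV \<longleftrightarrow> ((\<lambda>(xs, x). f (xs @ [x])) has_sum S) (UNIV \<times> UNIV)"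
proof -
  have inj: "inj_on (\<lambda>(xs, x). xs @ [x :: 'g]) (UNIV \<times> UNIV)" by (auto simp: inj_on_def)
  have "(f has_sum S) UNIV \<longleftrightarrow> (f has_sum S) ((\<lambda>(xs, x). xs @ [x]) ` (UNIV \<times> UNIV))"
  proof (rule has_sum_cong_neutral)
    fix ys :: "'g list" assume ys: "ys \<in> UNIV - (\<lambda>(xs, x). xs @ [x]) ` (UNIV \<times> UNIV)"
    show "f ys = 0"
    proof (cases ys rule: rev_cases)
      case (snoc zs z) then show ?thesis using ys by force
    qed (use assms in auto)
  qed auto
  then show ?thesis
    using has_sum_reindex[OF inj, of f S] by (simp add: o_def case_prod_unfold)
qed

lemma summable_snoc:
  fixes f :: "'g list \<Rightarrow> 'a :: {topological_comm_monoid_add, t2_space}"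
  assumes "f [] = 0"
  shows "f summable_on UNIV \<longleftrightarrow> (\<lambda>(xs, x). f (xs @ [x])) summable_on (UNIV \<times> UNIV)"
  unfolding summable_on_def has_sum_snoc[where f = f, OF assms] ..

lemma Rep_tensor_right:
  "Rep_ell2 (tensor_right \<psi> \<eta>) =
     (\<lambda>xs. if xs = [] then 0 else Rep_ell2 \<psi> (butlast xs) * Rep_ell2 \<eta> (last xs))"
  unfolding tensor_right_def
proof (rule Rep_Abs_ell2, subst summable_snoc)
  have "(\<lambda>(xs, x). (cmod (Rep_ell2 \<psi> xs * Rep_ell2 \<eta> x))\<^sup>2) summable_on UNIV \<times> UNIV"
  proof (rule summable_on_SigmaI)
    fix xs
    show "((\<lambda>x. case (xs, x) of (xs, x) \<Rightarrow> (cmod (Rep_ell2 \<psi> xs * Rep_ell2 \<eta> x))\<^sup>2) has_sum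
        (cmod (Rep_ell2 \<psi> xs))\<^sup>2 * (norm \<eta>)\<^sup>2) UNIV"
      using has_sum_cmult_right[OF norm_ell2_has_sum[of \<eta>]] by (simp add: norm_mult power_mult_distrib)
    show "(\<lambda>xs. (cmod (Rep_ell2 \<psi> xs))\<^sup>2 * (norm \<eta>)\<^sup>2) summable_on UNIV"
      by (intro summable_on_cmult_left Rep_ell2_summable)
  qed auto
  then show "(\<lambda>(xs, x). (cmod (if xs @ [x] = [] then 0 else 
      Rep_ell2 \<psi> (butlast (xs @ [x])) * Rep_ell2 \<eta> (last (xs @ [x]))))\<^sup>2) summable_on UNIV \<times> UNIV"
    by simp
qed simp

lemma single_has_sum: "(\<And>t. t \<noteq> s \<Longrightarrow> f t = 0) \<Longrightarrow> (f has_sum f s) UNIV"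
  using has_sum_cong_neutral[of UNIV "{s}" f f "f s"] has_sum_finite[of "{s}" f] by auto

lemma single_summable: "(\<lambda>t. (cmod (if t = s then 1 else 0))\<^sup>2) summable_on UNIV"
  using single_has_sum[of s "\<lambda>t. (cmod (if t = s then 1 else 0))\<^sup>2"] unfolding summable_on_def by auto

lemma elementary_tensor_0: "Rep_ell2 (elementary_tensor 0 \<xi>) = (\<lambda>xs. if xs = [] then 1 else 0)"
proof -
  have "elementary_tensor 0 \<xi> = Abs_ell2 (\<lambda>xs. if xs = [] then 1 else 0)"
    unfolding elementary_tensor_def by (rule arg_cong[of _ _ Abs_ell2]) (simp add: fun_eq_iff)
  then show ?thesis by (simp only: Rep_Abs_ell2[OF single_summable])
qed

lemma elementary_tensor_Suc:
  assumes "Rep_ell2 (elementary_tensor n \<xi>) = (\<lambda>xs. if length xs = n then \<Prod>i<n. Rep_ell2 (\<xi> i) (xs ! i) else 0)"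
  shows "elementary_tensor (Suc n) \<xi> = tensor_right (elementary_tensor n \<xi>) (\<xi> n)"
proof -
  have "(if length xs = Suc n then \<Prod>i<Suc n. Rep_ell2 (\<xi> i) (xs ! i) else 0) = 
      (if xs = [] then 0 else Rep_ell2 (elementary_tensor n \<xi>) (butlast xs) * Rep_ell2 (\<xi> n) (last xs))" for xs
    by (cases xs rule: rev_cases) (auto simp: assms nth_append intro!: prod.cong)
  then show ?thesis unfolding elementary_tensor_def[of "Suc n"] tensor_right_def by presburger
qed

lemma Rep_elementary_tensor:
  "Rep_ell2 (elementary_tensor n \<xi>) =
     (\<lambda>xs. if length xs = n then \<Prod>i<n. Rep_ell2 (\<xi> i) (xs ! i) else 0)"
proof (induction n)
  case 0 show ?case unfolding elementary_tensor_0 by auto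
next
  case (Suc n)
  show ?case unfolding elementary_tensor_Suc[OF Suc] Rep_tensor_right Suc
  proof
    fix xs :: "'a list"
    show "(if xs = [] then 0 else (if length (butlast xs) = n then \<Prod>i<n. Rep_ell2 (\<xi> i) (butlast xs ! i) else 0)
             * Rep_ell2 (\<xi> n) (last xs)) =
         (if length xs = Suc n then \<Prod>i<Suc n. Rep_ell2 (\<xi> i) (xs ! i) else 0)"
    by (cases xs rule: rev_cases) (auto simp: nth_append intro!: prod.cong)
  qed
qed

lemmas elementary_Suc = elementary_tensor_Suc[OF Rep_elementary_tensor]

definition last_slice :: "'g list ell2 \<Rightarrow> 'g list \<Rightarrow> 'g ell2" where
  "last_slice \<psi> xs = Abs_ell2 (\<lambda>g. Rep_ell2 \<psi> (xs @ [g]))"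

definition contract_last :: "'g list ell2 \<Rightarrow> 'g ell2 \<Rightarrow> 'g list ell2" where
  "contract_last \<psi> \<eta> = Abs_ell2 (\<lambda>xs. cinner (last_slice \<psi> xs) \<eta>)"

lemma Rep_last_slice: "Rep_ell2 (last_slice \<psi> xs) = (\<lambda>g. Rep_ell2 \<psi> (xs @ [g]))"
  unfolding last_slice_def
proof (rule Rep_Abs_ell2)
  have "(\<lambda>ys. (cmod (Rep_ell2 \<psi> ys))\<^sup>2) summable_on ((\<lambda>g. xs @ [g]) ` UNIV)"
    using Rep_ell2_summable by (rule summable_on_subset) auto
  then show "(\<lambda>g. (cmod (Rep_ell2 \<psi> (xs @ [g])))\<^sup>2) summable_on UNIV"
    by (subst (asm) summable_on_reindex) (auto simp: inj_on_def o_def)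
qed

lemma last_slice_has_sum:
  assumes "Rep_ell2 \<psi> [] = 0"
  shows "((\<lambda>xs. (norm (last_slice \<psi> xs))\<^sup>2) has_sum (norm \<psi>)\<^sup>2) UNIV"
proof (rule has_sum_SigmaD)
  show "((\<lambda>(xs, x). (cmod (Rep_ell2 \<psi> (xs @ [x])))\<^sup>2) has_sum (norm \<psi>)\<^sup>2) (UNIV \<times> UNIV)"
    using norm_ell2_has_sum[of \<psi>] by (subst (asm) has_sum_snoc) (simp_all add: assms)
  show "((\<lambda>y. case (xs, y) of (xs, x) \<Rightarrow> (cmod (Rep_ell2 \<psi> (xs @ [x])))\<^sup>2) has_sum (norm (last_slice \<psi> xs))\<^sup>2) UNIV" for xs
    using norm_ell2_has_sum[of "last_slice \<psi> xs"] by (simp add: Rep_last_slice)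
qed

lemma Rep_contract_last:
  assumes "Rep_ell2 \<psi> [] = 0"
  shows "Rep_ell2 (contract_last \<psi> \<eta>) = (\<lambda>xs. cinner (last_slice \<psi> xs) \<eta>)"
  unfolding contract_last_def
proof (rule Rep_Abs_ell2, rule summable_on_comparison_test)
  show "(\<lambda>xs. (norm (last_slice \<psi> xs))\<^sup>2 * (norm \<eta>)\<^sup>2) summable_on UNIV"
    using last_slice_has_sum[OF assms] by (intro summable_on_cmult_left) (auto simp: summable_on_def)
  show "(cmod (cinner (last_slice \<psi> xs) \<eta>))\<^sup>2 \<le> (norm (last_slice \<psi> xs))\<^sup>2 * (norm \<eta>)\<^sup>2" for xs
    using power_mono[OF cmod_cinner_le[of "last_slice \<psi> xs" \<eta>], of 2] by (simp add: power_mult_distrib)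
qed auto

lemma cinner_contract_last:
  assumes "Rep_ell2 \<psi> [] = 0"
  shows "cinner \<psi> (tensor_right \<chi>' \<eta>) = cinner (contract_last \<psi> \<eta>) \<chi>'"
proof -
  have "((\<lambda>xs. cinner (last_slice \<psi> xs) \<eta> * cnj (Rep_ell2 \<chi>' xs)) has_sum cinner \<psi> (tensor_right \<chi>' \<eta>)) UNIV"
  proof (rule has_sum_SigmaD)
    show "((\<lambda>(xs, x). Rep_ell2 \<psi> (xs @ [x]) * cnj (Rep_ell2 (tensor_right \<chi>' \<eta>) (xs @ [x])))
       has_sum cinner \<psi> (tensor_right \<chi>' \<eta>)) (UNIV \<times> UNIV)"
      using cinner_ell2_has_sum[of \<psi> "tensor_right \<chi>' \<eta>"] by (subst (asm) has_sum_snoc) (simp_all add: assms)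
    show "((\<lambda>y. case (xs, y) of (xs, x) \<Rightarrow> Rep_ell2 \<psi> (xs @ [x]) * cnj (Rep_ell2 (tensor_right \<chi>' \<eta>) (xs @ [x])))
       has_sum cinner (last_slice \<psi> xs) \<eta> * cnj (Rep_ell2 \<chi>' xs)) UNIV" for xs
      using has_sum_cmult_left[OF cinner_ell2_has_sum[of "last_slice \<psi> xs" \<eta>], of "cnj (Rep_ell2 \<chi>' xs)"]
      by (simp add: Rep_last_slice Rep_tensor_right mult_ac)
  qed
  moreover have "((\<lambda>xs. cinner (last_slice \<psi> xs) \<eta> * cnj (Rep_ell2 \<chi>' xs)) has_sum cinner (contract_last \<psi> \<eta>) \<chi>') UNIV"
    using cinner_ell2_has_sum[of "contract_last \<psi> \<eta>" \<chi>'] by (simp add: Rep_contract_last[OF assms])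
  ultimately show ?thesis by (rule has_sum_unique)
qed

lemma cinner_tensor_right:
  "cinner (tensor_right \<psi> \<eta>) (tensor_right \<psi>' \<eta>') = cinner \<psi> \<psi>' * cinner \<eta> \<eta>'"
proof -
  have *: "Rep_ell2 (tensor_right \<psi> \<eta>) [] = 0" by (simp add: Rep_tensor_right)
  have "last_slice (tensor_right \<psi> \<eta>) xs = Rep_ell2 \<psi> xs *\<^sub>C \<eta>" for xs
    by (rule Rep_ell2_inject[THEN iffD1]) (simp add: Rep_last_slice Rep_tensor_right scaleC_ell2.rep_eq)
  then have "contract_last (tensor_right \<psi> \<eta>) \<eta>' = cinner \<eta> \<eta>' *\<^sub>C \<psi>"
    by (intro Rep_ell2_inject[THEN iffD1]) 
       (simp add: Rep_contract_last[OF *] scaleC_ell2.rep_eq cinner_scaleC_left mult.commute)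
  then show ?thesis by (simp add: cinner_contract_last[OF *] cinner_scaleC_left)
qed

lemma tensor_power_contract_last: "\<psi> \<in> tensor_power (Suc n) \<Longrightarrow> contract_last \<psi> \<eta> \<in> tensor_power n"
proof -
  assume \<psi>: "\<psi> \<in> tensor_power (Suc n)"
  then have 0: "Rep_ell2 \<psi> [] = 0" by (simp add: tensor_power_def)
  have "last_slice \<psi> xs = 0" if "length xs \<noteq> n" for xs
    using \<psi> that by (intro Rep_ell2_inject[THEN iffD1]) 
       (simp add: Rep_last_slice zero_ell2.rep_eq tensor_power_def)
  moreover have "cinner 0 \<eta> = 0" using cmod_cinner_le[of 0 \<eta>] by simp
  ultimately show ?thesis by (simp add: tensor_power_def Rep_contract_last[OF 0])
qed

lemma tensor_power_right: "\<psi> \<in> tensor_power n \<Longrightarrow> tensor_right \<psi> \<eta> \<in> tensor_power (Suc n)"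
  unfolding tensor_power_def Rep_tensor_right mem_Collect_eq
proof (intro allI impI)
  fix xs :: "'a list"
  assume \<psi>: "\<forall>xs. length xs \<noteq> n \<longrightarrow> Rep_ell2 \<psi> xs = 0" and xs: "length xs \<noteq> Suc n"
  show "(if xs = [] then 0 else Rep_ell2 \<psi> (butlast xs) * Rep_ell2 \<eta> (last xs)) = 0"
  proof (cases xs rule: rev_cases)
    case (snoc ys y)
    then have "Rep_ell2 \<psi> ys = 0" using \<psi> xs by simp
    then show ?thesis using snoc by simp
  qed simp
qed

lemma tensor_power_elementary: "elementary_tensor n \<xi> \<in> tensor_power n"
  by (simp add: tensor_power_def Rep_elementary_tensor)

lemma cinner_elementary:
  "cinner (elementary_tensor n \<xi>) (elementary_tensor n \<zeta>) = (\<Prod>i<n. cinner (\<xi> i) (\<zeta> i))"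
proof (induction n)
  case 0
  let ?f = "\<lambda>i. Rep_ell2 (elementary_tensor 0 \<xi>) i * cnj (Rep_ell2 (elementary_tensor 0 \<zeta>) i)"
  have "(?f has_sum ?f []) UNIV" by (rule single_has_sum) (simp add: elementary_tensor_0)
  then have "cinner (elementary_tensor 0 \<xi>) (elementary_tensor 0 \<zeta>) = ?f []"
    using cinner_ell2_has_sum has_sum_unique by blast
  then show ?case by (simp add: elementary_tensor_0)
next
  case (Suc n) then show ?case by (simp add: elementary_Suc cinner_tensor_right)
qed

definition ell2_basis :: "'a \<Rightarrow> 'a ell2" where "ell2_basis s = Abs_ell2 (\<lambda>t. if t = s then 1 else 0)"

lemma Rep_basis: "Rep_ell2 (ell2_basis s) = (\<lambda>t. if t = s then 1 else 0)"
  unfolding ell2_basis_def by (rule Rep_Abs_ell2[OF single_summable])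

lemma cinner_basis: "cinner f (ell2_basis s) = Rep_ell2 f s"
proof -
  let ?f = "\<lambda>i. Rep_ell2 f i * cnj (Rep_ell2 (ell2_basis s) i)"
  have "(?f has_sum ?f s) UNIV" by (rule single_has_sum) (simp add: Rep_basis)
  then have "cinner f (ell2_basis s) = ?f s" using cinner_ell2_has_sum has_sum_unique by blast
  then show ?thesis by (simp add: Rep_basis)
qed

text \<open>A Householder reflection gives an orthonormal basis through a given unit vector.\<close>

lemma ex_onb:
  fixes \<phi> :: "'a ell2" and z :: 'a
  assumes "norm \<phi> = 1"
  shows "\<exists>b. b z = \<phi> \<and> (\<forall>s t. cinner (b s) (b t) = (if s = t then 1 else 0)) \<and>
    (\<forall>f. ((\<lambda>s. (cmod (cinner f (b s)))\<^sup>2) has_sum (norm f)\<^sup>2) UNIV)"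
proof -
  define e where "e = ell2_basis z"
  have ee: "cinner e e = 1" by (simp add: e_def cinner_basis Rep_basis)
  define \<omega> where "\<omega> = (if cinner \<phi> e = 0 then 1 else cnj (cinner \<phi> e) / cmod (cinner \<phi> e))"
  have \<omega>: "cmod \<omega> = 1" by (simp add: \<omega>_def norm_divide)
  have \<omega>2: "\<omega> * cnj \<omega> = 1" using \<omega> by (simp add: complex_norm_square[symmetric])
  define p where "p = \<omega> *\<^sub>C \<phi>"
  define r where "r = cmod (cinner \<phi> e)"
  have pe: "cinner p e = complex_of_real r"
    using complex_norm_square[of "cinner \<phi> e"]
    by (auto simp: p_def r_def cinner_scaleC_left \<omega>_def field_simps power2_eq_square)
  have ep: "cinner e p = complex_of_real r" using pe cinner_commute[of e p] by simp
  have pp: "cinner p p = 1" by (simp add: cinner_self p_def norm_scaleC \<omega> assms)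
  define w where "w = e - p"
  have ww: "cinner w w = 2 * (1 - complex_of_real r)" 
    by (simp add: w_def cinner_diff_left cinner_diff_right ee pp ep pe)
  define c where "c = (if w = 0 then 0 else inverse (1 - r))"
  have c: "c * (c * (2 * (1 - r))) = 2 * c"
  proof (cases "w = 0")
    case False
    then have "1 - r \<noteq> 0" using ww cinner_self[of w] by auto
    then have "c * (1 - r) = 1" using False by (simp add: c_def)
    moreover have "c * (c * (2 * (1 - r))) = 2 * c * (c * (1 - r))" by (simp add: algebra_simps)
    ultimately show ?thesis by simp
  qed (simp add: c_def)
  define V where "V x = x - (complex_of_real c * cinner x w) *\<^sub>C w" for x
  have Vsa: "cinner (V x) y = cinner x (V y)" for x y
    by (simp add: V_def cinner_diff_left cinner_diff_right cinner_scaleC_left cinner_scaleC_right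
      cinner_commute[of w y])
  have VV: "cinner (V x) (V y) = cinner x y" for x y
  proof -
    have "cinner (V x) (V y) = cinner x y - 2 * complex_of_real c * cinner x w * cinner w y
       + complex_of_real c * complex_of_real c * cinner x w * cinner w y * cinner w w"
      by (simp add: V_def cinner_diff_left cinner_diff_right cinner_scaleC_left cinner_scaleC_right
        cinner_commute[of w y] algebra_simps)
    also have "complex_of_real c * complex_of_real c * cinner x w * cinner w y * cinner w w
        = complex_of_real (c * (c * (2 * (1 - r)))) * cinner x w * cinner w y" by (simp add: ww)
    finally show ?thesis unfolding c by simp
  qed
  have Ve: "V e = p"
  proof (cases "w = 0")
    case True then have "e = p" by (simp add: w_def)
    moreover have "0 *\<^sub>C w = 0" using scaleC_add_left[of 0 0 w] by simp
    ultimately show ?thesis using True by (simp add: V_def c_def)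
  next
    case False
    then have "1 - r \<noteq> 0" using ww cinner_self[of w] by auto
    moreover have "cinner e w = 1 - complex_of_real r" by (simp add: w_def cinner_diff_right ee ep)
    moreover have "complex_of_real (1 - r) \<noteq> 0" using \<open>1 - r \<noteq> 0\<close> by (simp only: of_real_eq_0_iff not_False_eq_True)
    ultimately have "complex_of_real c * cinner e w = 1" using False by (simp add: c_def)
    then show ?thesis by (simp add: V_def scaleC_one) (simp add: w_def)
  qed
  define b where "b s = cnj \<omega> *\<^sub>C V (ell2_basis s)" for s
  have "b z = \<phi>" by (simp add: b_def Ve flip: e_def) (simp add: p_def scaleC_scaleC mult.commute \<omega>2 scaleC_one)
  moreover have "cinner (b s) (b t) = (if s = t then 1 else 0)" for s t
    using \<omega>2 by (simp add: b_def cinner_scaleC_left cinner_scaleC_right VV cinner_basis Rep_basis mult.commute)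
  moreover have "((\<lambda>s. (cmod (cinner f (b s)))\<^sup>2) has_sum (norm f)\<^sup>2) UNIV" for f
  proof -
    have "cinner f (b s) = \<omega> * Rep_ell2 (V f) s" for s
      by (simp add: b_def cinner_scaleC_right Vsa[symmetric] cinner_basis)
    moreover have "(norm (V f))\<^sup>2 = (norm f)\<^sup>2"
      using VV[of f f] unfolding cinner_self of_real_eq_iff .
    ultimately show ?thesis using norm_ell2_has_sum[of "V f"] by (simp add: norm_mult \<omega>)
  qed
  ultimately show ?thesis by blast
qed


lemma parseval_tensor:
  fixes b :: "nat \<Rightarrow> 'g \<Rightarrow> 'g ell2"
  assumes b: "\<And>i f. ((\<lambda>s. (cmod (cinner f (b i s)))\<^sup>2) has_sum (norm f)\<^sup>2) UNIV"
  shows "\<psi> \<in> tensor_power n \<Longrightarrow>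
    ((\<lambda>xs. if length xs = n then (cmod (cinner \<psi> (elementary_tensor n (\<lambda>i. b i (xs ! i)))))\<^sup>2 else 0)
      has_sum (norm \<psi>)\<^sup>2) UNIV"
proof (induction n arbitrary: \<psi>)
  case 0
  then have z: "Rep_ell2 \<psi> xs = 0" if "xs \<noteq> []" for xs using that by (simp add: tensor_power_def)
  have "((\<lambda>xs. (cmod (Rep_ell2 \<psi> xs))\<^sup>2) has_sum (cmod (Rep_ell2 \<psi> []))\<^sup>2) UNIV"
    by (rule single_has_sum) (simp add: z)
  then have n: "(norm \<psi>)\<^sup>2 = (cmod (Rep_ell2 \<psi> []))\<^sup>2"
    using norm_ell2_has_sum has_sum_unique by blast
  have "elementary_tensor 0 \<xi> = ell2_basis []" for \<xi> :: "nat \<Rightarrow> 'g ell2"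
    by (rule Rep_ell2_inject[THEN iffD1]) (simp add: elementary_tensor_0 Rep_basis)
  then have c: "cinner \<psi> (elementary_tensor 0 \<xi>) = Rep_ell2 \<psi> []" for \<xi>
    by (simp add: cinner_basis)
  show ?case
    using single_has_sum[of "[]" "\<lambda>xs. if length xs = 0 then (cmod (cinner \<psi> (elementary_tensor 0 (\<lambda>i. b i (xs ! i)))))\<^sup>2 else 0"]
    by (simp add: c n)
next
  case (Suc n)
  have 0: "Rep_ell2 \<psi> [] = 0" using Suc.prems by (simp add: tensor_power_def)
  let ?h = "\<lambda>(x, xs). if length xs = n then (cmod (cinner (contract_last \<psi> (b n x)) (elementary_tensor n (\<lambda>i. b i (xs ! i)))))\<^sup>2 else 0"
  have c: "cinner \<psi> (elementary_tensor (Suc n) (\<lambda>i. b i ((xs @ [x]) ! i))) =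
     cinner (contract_last \<psi> (b n x)) (elementary_tensor n (\<lambda>i. b i (xs ! i)))" if "length xs = n" for xs x
  proof -
    have "elementary_tensor n (\<lambda>i. b i ((xs @ [x]) ! i)) = elementary_tensor n (\<lambda>i. b i (xs ! i))"
      unfolding elementary_tensor_def using that
      by (intro arg_cong[of _ _ Abs_ell2] ext) (auto simp: nth_append intro!: prod.cong)
    then have "elementary_tensor (Suc n) (\<lambda>i. b i ((xs @ [x]) ! i)) = 
        tensor_right (elementary_tensor n (\<lambda>i. b i (xs ! i))) (b n x)"
      using that by (simp add: elementary_Suc nth_append)
    then show ?thesis by (simp add: cinner_contract_last[OF 0])
  qed
  have inner: "((\<lambda>xs. ?h (x, xs)) has_sum (norm (contract_last \<psi> (b n x)))\<^sup>2) UNIV" for x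
    using Suc.IH[OF tensor_power_contract_last[OF Suc.prems], of "b n x"] by simp
  have outer: "((\<lambda>x. (norm (contract_last \<psi> (b n x)))\<^sup>2) has_sum (norm \<psi>)\<^sup>2) UNIV"
  proof (rule has_sum_SigmaD)
    let ?k = "\<lambda>(x, xs). (cmod (cinner (last_slice \<psi> xs) (b n x)))\<^sup>2"
    show "((\<lambda>y. ?k (x, y)) has_sum (norm (contract_last \<psi> (b n x)))\<^sup>2) UNIV" for x
      using norm_ell2_has_sum[of "contract_last \<psi> (b n x)"] by (simp add: Rep_contract_last[OF 0])
    have k: "((\<lambda>x. case (xs, x) of (xs, x) \<Rightarrow> ?k (x, xs)) has_sum (norm (last_slice \<psi> xs))\<^sup>2) UNIV" for xs
      using b[of "last_slice \<psi> xs" n] by simp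
    have "(\<lambda>(xs, x). ?k (x, xs)) summable_on UNIV \<times> UNIV"
      by (rule summable_on_SigmaI[OF k])
         (use last_slice_has_sum[OF 0] in \<open>auto simp: summable_on_def\<close>)
    then have "((\<lambda>(xs, x). ?k (x, xs)) has_sum (norm \<psi>)\<^sup>2) (UNIV \<times> UNIV)"
      by (rule has_sum_SigmaI[OF k last_slice_has_sum[OF 0]])
    then show "(?k has_sum (norm \<psi>)\<^sup>2) (UNIV \<times> UNIV)"
      by (subst has_sum_swap) simp
  qed
  have "?h summable_on UNIV \<times> UNIV"
    by (rule summable_on_SigmaI[OF inner]) (use outer in \<open>auto simp: summable_on_def\<close>)
  then have "(?h has_sum (norm \<psi>)\<^sup>2) (UNIV \<times> UNIV)"
    by (rule has_sum_SigmaI[OF inner outer])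
  then have "((\<lambda>(xs, x). ?h (x, xs)) has_sum (norm \<psi>)\<^sup>2) (UNIV \<times> UNIV)"
    by (subst has_sum_swap) simp
  also have "?this \<longleftrightarrow> ((\<lambda>(xs, x). if length (xs @ [x]) = Suc n then
      (cmod (cinner \<psi> (elementary_tensor (Suc n) (\<lambda>i. b i ((xs @ [x]) ! i)))))\<^sup>2 else 0)
      has_sum (norm \<psi>)\<^sup>2) (UNIV \<times> UNIV)"
    by (intro has_sum_cong) (use c in auto)
  finally show ?case
    by (subst has_sum_snoc) simp_all
qed

typedef (overloaded) 'g finseq = "{s :: nat \<Rightarrow> 'g::zero. \<exists>n. \<forall>i\<ge>n. s i = 0}"
  by (rule exI[of _ "\<lambda>_. 0"]) simp

lemma finseq_bij:
  "bij_betw (\<lambda>xs. Abs_finseq (\<lambda>i. if i < length xs then xs ! i else 0))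
     {xs. length xs = n} {s :: 'g::zero finseq. \<forall>i\<ge>n. Rep_finseq s i = 0}"
proof (rule bij_betwI[where g = "\<lambda>s. map (Rep_finseq s) [0..<n]"])
  have R: "Rep_finseq (Abs_finseq (\<lambda>i. if i < length xs then xs ! i else 0)) = 
      (\<lambda>i. if i < length xs then xs ! i else 0)" for xs :: "'g list"
    by (rule Abs_finseq_inverse) (auto intro!: exI[of _ "length xs"])
  show "(\<lambda>xs. Abs_finseq (\<lambda>i. if i < length xs then xs ! i else 0)) \<in>
      {xs. length xs = n} \<rightarrow> {s :: 'g finseq. \<forall>i\<ge>n. Rep_finseq s i = 0}" by (auto simp: R)
  show "map (Rep_finseq (Abs_finseq (\<lambda>i. if i < length xs then xs ! i else 0))) [0..<n] = xs"
    if "xs \<in> {xs. length xs = n}" for xs :: "'g list"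
    using that by (auto simp: R intro!: nth_equalityI)
  show "Abs_finseq (\<lambda>i. if i < length (map (Rep_finseq s) [0..<n]) then map (Rep_finseq s) [0..<n] ! i else 0) = s"
    if "s \<in> {s. \<forall>i\<ge>n. Rep_finseq s i = 0}" for s :: "'g finseq"
  proof -
    have "(\<lambda>i. if i < length (map (Rep_finseq s) [0..<n]) then map (Rep_finseq s) [0..<n] ! i else 0) = Rep_finseq s"
      using that by auto
    then show ?thesis by (simp only: Rep_finseq_inverse)
  qed
qed auto

lemma elementary_cong: "(\<And>i. i < n \<Longrightarrow> \<xi> i = \<zeta> i) \<Longrightarrow> elementary_tensor n \<xi> = elementary_tensor n \<zeta>"
  unfolding elementary_tensor_def by (intro arg_cong[of _ _ Abs_ell2] ext) auto

theorem infinite_tensor_product_exists: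
  fixes \<phi> :: "nat \<Rightarrow> 'g::zero ell2"
  assumes "\<And>i. norm (\<phi> i) = 1"
  shows "\<exists>J :: nat \<Rightarrow> 'g list ell2 \<Rightarrow> 'g finseq ell2. infinite_tensor_product \<phi> J"
proof -
  obtain b :: "nat \<Rightarrow> 'g \<Rightarrow> 'g ell2" where b0: "\<And>i. b i 0 = \<phi> i"
    and orth: "\<And>i s t. cinner (b i s) (b i t) = (if s = t then 1 else 0)"
    and pars: "\<And>i f. ((\<lambda>s. (cmod (cinner f (b i s)))\<^sup>2) has_sum (norm f)\<^sup>2) UNIV"
    using ex_onb[OF assms, where z = 0] by metis
  define B where "B n s = elementary_tensor n (\<lambda>i. b i (Rep_finseq s i))" for n and s :: "'g finseq"
  define S where "S n = {s :: 'g finseq. \<forall>i\<ge>n. Rep_finseq s i = 0}" for n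
  define J where "J n \<psi> = Abs_ell2 (\<lambda>s. if s \<in> S n then cinner \<psi> (B n s) else 0)" for n \<psi>
  have norm_sum: "((\<lambda>s. (cmod (if s \<in> S n then cinner \<psi> (B n s) else 0))\<^sup>2) has_sum (norm \<psi>)\<^sup>2) UNIV"
    if "\<psi> \<in> tensor_power n" for n \<psi>
  proof -
    have "((\<lambda>xs. (cmod (cinner \<psi> (elementary_tensor n (\<lambda>i. b i (xs ! i)))))\<^sup>2) has_sum (norm \<psi>)\<^sup>2) {xs. length xs = n}"
      using parseval_tensor[where b = b, OF pars that]
        has_sum_cong_neutral[where T = UNIV and S = "{xs. length xs = n}"
          and f = "\<lambda>xs. (cmod (cinner \<psi> (elementary_tensor n (\<lambda>i. b i (xs ! i)))))\<^sup>2"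
          and g = "\<lambda>xs. if length xs = n then (cmod (cinner \<psi> (elementary_tensor n (\<lambda>i. b i (xs ! i)))))\<^sup>2 else 0"
          and x = "(norm \<psi>)\<^sup>2"] by auto
    also have "?this \<longleftrightarrow> ((\<lambda>xs. (cmod (cinner \<psi> (B n (Abs_finseq (\<lambda>i. if i < length xs then xs ! i else 0)))))\<^sup>2) has_sum (norm \<psi>)\<^sup>2) {xs. length xs = n}"
    proof (rule has_sum_cong)
      fix xs :: "'g list" assume "xs \<in> {xs. length xs = n}"
      moreover have "Rep_finseq (Abs_finseq (\<lambda>i. if i < length xs then xs ! i else 0)) = (\<lambda>i. if i < length xs then xs ! i else 0)"
        by (rule Abs_finseq_inverse) (auto intro!: exI[of _ "length xs"])
      ultimately have "elementary_tensor n (\<lambda>i. b i (xs ! i)) = B n (Abs_finseq (\<lambda>i. if i < length xs then xs ! i else 0))"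
        unfolding B_def by (intro elementary_cong) auto
      then show "(cmod (cinner \<psi> (elementary_tensor n (\<lambda>i. b i (xs ! i)))))\<^sup>2 =
         (cmod (cinner \<psi> (B n (Abs_finseq (\<lambda>i. if i < length xs then xs ! i else 0)))))\<^sup>2" by simp
    qed
    also have "\<dots> \<longleftrightarrow> ((\<lambda>s. (cmod (cinner \<psi> (B n s)))\<^sup>2) has_sum (norm \<psi>)\<^sup>2) (S n)"
      unfolding S_def by (rule has_sum_reindex_bij_betw[OF finseq_bij])
    finally show ?thesis
      using has_sum_cong_neutral[where T = UNIV and S = "S n" and f = "\<lambda>s. (cmod (cinner \<psi> (B n s)))\<^sup>2"
        and g = "\<lambda>s. (cmod (if s \<in> S n then cinner \<psi> (B n s) else 0))\<^sup>2" and x = "(norm \<psi>)\<^sup>2"] by auto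
  qed
  have RJ: "Rep_ell2 (J n \<psi>) = (\<lambda>s. if s \<in> S n then cinner \<psi> (B n s) else 0)"
    if "\<psi> \<in> tensor_power n" for n \<psi>
    unfolding J_def by (rule Rep_Abs_ell2) (use norm_sum[OF that] in \<open>auto simp: summable_on_def\<close>)
  have tp_add: "\<psi> + \<psi>' \<in> tensor_power n" if "\<psi> \<in> tensor_power n" "\<psi>' \<in> tensor_power n" for n and \<psi> \<psi>' :: "'g list ell2"
    using that by (simp add: tensor_power_def plus_ell2.rep_eq)
  have tp_scale: "c *\<^sub>C \<psi> \<in> tensor_power n" if "\<psi> \<in> tensor_power n" for n c and \<psi> :: "'g list ell2"
    using that by (simp add: tensor_power_def scaleC_ell2.rep_eq)
  have "J n (\<psi> + \<psi>') = J n \<psi> + J n \<psi>'" if "\<psi> \<in> tensor_power n" "\<psi>' \<in> tensor_power n" for n \<psi> \<psi>'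
    by (rule Rep_ell2_inject[THEN iffD1]) (auto simp: RJ that tp_add plus_ell2.rep_eq cinner_add_left)
  moreover have "J n (c *\<^sub>C \<psi>) = c *\<^sub>C J n \<psi>" if "\<psi> \<in> tensor_power n" for n c \<psi>
    by (rule Rep_ell2_inject[THEN iffD1]) (auto simp: RJ that tp_scale scaleC_ell2.rep_eq cinner_scaleC_left)
  moreover have "norm (J n \<psi>) = norm \<psi>" if "\<psi> \<in> tensor_power n" for n \<psi>
  proof -
    have "(norm (J n \<psi>))\<^sup>2 = (norm \<psi>)\<^sup>2"
      using norm_ell2_has_sum[of "J n \<psi>"] norm_sum[OF that] unfolding RJ[OF that] by (rule has_sum_unique)
    then show ?thesis by (rule power2_eq_imp_eq) auto
  qed
  moreover have "J (Suc n) (tensor_right \<psi> (\<phi> n)) = J n \<psi>" if "\<psi> \<in> tensor_power n" for n \<psi>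
  proof (rule Rep_ell2_inject[THEN iffD1], unfold RJ[OF that] RJ[OF tensor_power_right[OF that]], rule ext)
    fix s :: "'g finseq"
    have "cinner (tensor_right \<psi> (\<phi> n)) (B (Suc n) s) = cinner \<psi> (B n s) * cinner (b n 0) (b n (Rep_finseq s n))"
      by (simp add: B_def elementary_Suc cinner_tensor_right b0)
    moreover have "s \<in> S n \<longleftrightarrow> s \<in> S (Suc n) \<and> Rep_finseq s n = 0"
    proof -
      have "(\<forall>i\<ge>n. Rep_finseq s i = 0) \<longleftrightarrow> (\<forall>i\<ge>Suc n. Rep_finseq s i = 0) \<and> Rep_finseq s n = 0"
      proof (intro iffI conjI allI impI)
        fix i assume "(\<forall>i\<ge>Suc n. Rep_finseq s i = 0) \<and> Rep_finseq s n = 0" "n \<le> i"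
        then show "Rep_finseq s i = 0" by (cases "i = n") auto
      qed auto
      then show ?thesis by (simp add: S_def)
    qed
    ultimately show "(if s \<in> S (Suc n) then cinner (tensor_right \<psi> (\<phi> n)) (B (Suc n) s) else 0) =
       (if s \<in> S n then cinner \<psi> (B n s) else 0)"
      by (auto simp: orth)
  qed
  moreover have "closure (\<Union>n. J n ` tensor_power n) = UNIV"
  proof -
    have "\<exists>y\<in>\<Union>n. J n ` tensor_power n. dist y f < e" if "e > 0" for f :: "'g finseq ell2" and e
    proof -
      define d where "d = e / 2"
      have d: "d > 0" using that by (simp add: d_def)
      obtain F where F: "finite F" "dist (\<Sum>s\<in>F. (cmod (Rep_ell2 f s))\<^sup>2) ((norm f)\<^sup>2) \<le> d\<^sup>2"
        using has_sum_finite_approximation[OF norm_ell2_has_sum[of f], of "d\<^sup>2"] d by auto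
      have "\<exists>n. s \<in> S n" for s using Rep_finseq[of s] by (auto simp: S_def)
      then obtain N where N: "\<And>s. s \<in> S (N s)" by metis
      define n where "n = Max (insert 0 (N ` F))"
      have FS: "F \<subseteq> S n"
      proof
        fix s assume "s \<in> F"
        then have "N s \<le> n" using F(1) by (simp add: n_def)
        then show "s \<in> S n" using N[of s] by (auto simp: S_def)
      qed
      define \<psi> where "\<psi> = (\<Sum>s\<in>F. Rep_ell2 f s *\<^sub>C B n s)"
      have tp0: "(0 :: 'g list ell2) \<in> tensor_power n" by (simp add: tensor_power_def zero_ell2.rep_eq)
      have tpB: "B n s \<in> tensor_power n" for s unfolding B_def by (rule tensor_power_elementary)
      have "\<psi> \<in> tensor_power n" unfolding \<psi>_def
        using F(1) by (induction F rule: finite_induct) (simp_all add: tp0 tp_add tp_scale tpB)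
      have orthB: "cinner (B n s) (B n t) = (if s = t then 1 else 0)" if "s \<in> S n" "t \<in> S n" for s t
      proof (cases "s = t")
        case False
        then have "Rep_finseq s \<noteq> Rep_finseq t" by (simp add: Rep_finseq_inject)
        then obtain i where i: "Rep_finseq s i \<noteq> Rep_finseq t i" by auto
        have "\<not> n \<le> i" using i that by (auto simp: S_def)
        then have "i < n" by simp
        then show ?thesis using i False unfolding B_def cinner_elementary orth
          by (auto intro!: prod_zero)
      qed (simp add: B_def cinner_elementary orth)
      have cs: "cinner (\<Sum>s\<in>F. Rep_ell2 f s *\<^sub>C B n s) y = (\<Sum>s\<in>F. Rep_ell2 f s * cinner (B n s) y)" for y
        using F(1)
      proof (induction F rule: finite_induct)
        case empty
        have "cinner 0 y = 0" using cmod_cinner_le[of 0 y] by simp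
        then show ?case by simp
      qed (simp add: cinner_add_left cinner_scaleC_left)
      have R: "Rep_ell2 (J n \<psi>) t = (if t \<in> F then Rep_ell2 f t else 0)" for t
      proof (cases "t \<in> S n")
        case True
        have "(\<Sum>s\<in>F. Rep_ell2 f s * cinner (B n s) (B n t)) = (\<Sum>s\<in>F. if s = t then Rep_ell2 f s else 0)"
          using FS True by (intro sum.cong) (auto simp: orthB)
        then show ?thesis using True F(1) by (simp add: RJ[OF \<open>\<psi> \<in> _\<close>]) (simp add: \<psi>_def cs)
      next
        case False then show ?thesis using FS by (auto simp: RJ[OF \<open>\<psi> \<in> _\<close>])
      qed
      have "norm (J n \<psi> - f) \<le> d"
      proof (rule norm_ell2_le)
        fix G :: "'g finseq set" assume G: "finite G"
        have "(\<Sum>i\<in>G. (cmod (Rep_ell2 (J n \<psi> - f) i))\<^sup>2) = (\<Sum>i\<in>G - F. (cmod (Rep_ell2 f i))\<^sup>2)"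
          using G by (intro sum.mono_neutral_cong_right) (auto simp: minus_ell2.rep_eq R)
        also have "\<dots> = (\<Sum>i\<in>G \<union> F. (cmod (Rep_ell2 f i))\<^sup>2) - (\<Sum>i\<in>F. (cmod (Rep_ell2 f i))\<^sup>2)"
          using sum.subset_diff[of F "G \<union> F" "\<lambda>i. (cmod (Rep_ell2 f i))\<^sup>2"] G F(1)
          by (simp add: Un_Diff)
        also have "\<dots> \<le> (norm f)\<^sup>2 - (\<Sum>i\<in>F. (cmod (Rep_ell2 f i))\<^sup>2)"
          using sum_le_norm_ell2[of "G \<union> F" f] G F(1) by simp
        also have "\<dots> \<le> d\<^sup>2" using F(2) by (simp add: dist_real_def)
        finally show "(\<Sum>i\<in>G. (cmod (Rep_ell2 (J n \<psi> - f) i))\<^sup>2) \<le> d\<^sup>2" .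
      qed (use d in simp)
      then have "dist (J n \<psi>) f < e" using that by (simp add: dist_norm d_def)
      then show ?thesis using \<open>\<psi> \<in> _\<close> by blast
    qed
    then show ?thesis by (auto simp: closure_approachable)
  qed
  ultimately have "infinite_tensor_product \<phi> J" unfolding infinite_tensor_product_def by blast
  then show ?thesis by blast
qed

end

theory Submission
  imports Defs
begin

text \<open>Write \<open>V\<^sub>i = \<lambda>\<^bsub>u\<^sub>i\<^esub>(g)\<close>. The projection onto the vacuum \<open>\<Otimes>\<^sub>i \<phi>\<^sub>i\<close> lies in the von Neumann tensor
  product, being the strong limit of finite products of the projections onto \<open>\<phi>\<^sub>i\<close> in the \<open>i\<close>-th factor.
  An extension of the product action maps it to a non-zero projection lying below the projections onto
  \<open>V\<^sub>i \<phi>\<^sub>i\<close> in the \<open>i\<close>-th factor, for all \<open>i\<close>. On a fixed vector the latter projections behave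
  asymptotically like the scalars \<open>|\<langle>\<phi>\<^sub>i, V\<^sub>i \<phi>\<^sub>i\<rangle>|\<^sup>2\<close>, so \<open>|\<langle>\<phi>\<^sub>i, V\<^sub>i \<phi>\<^sub>i\<rangle>| \<rightarrow> 1\<close> for every \<open>g\<close>. For
  uncountable \<open>G\<close> some \<open>g\<close> moves the countable union of the supports of the \<open>\<phi>\<^sub>i\<close> off itself, which
  makes all these overlaps vanish; in general a cluster point of the vector states of the \<open>\<phi>\<^sub>i\<close> is an
  invariant mean.\<close>

section \<open>Orthogonal projections and elementary tensors\<close>

lemma cinner_zero_left [simp]: "cinner 0 y = 0"
  using cmod_cinner_le[of 0 y] by simp

lemma bounded_linear_cinner_left: "bounded_linear (\<lambda>x. cinner x y)"
  by (rule bounded_linear_intro[where K = "norm y"])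
     (simp_all add: cinner_add_left scaleR_scaleC cinner_scaleC_left scaleR_conv_of_real cmod_cinner_le)

lemma bounded_linear_scaleC: "bounded_linear (\<lambda>x :: 'a::complex_inner. c *\<^sub>C x)"
  by (rule bounded_linear_intro[where K = "cmod c"])
     (simp_all add: scaleC_add_right scaleR_scaleC scaleC_scaleC norm_scaleC mult.commute)

lemma scaleC_zero_left [simp]: "0 *\<^sub>C (x :: 'a::complex_inner) = 0"
  using norm_scaleC[of 0 x] by simp

lemma scaleC_diff_right: "c *\<^sub>C (x - y) = c *\<^sub>C x - c *\<^sub>C (y :: 'a::complex_inner)"
  using bounded_linear.linear[OF bounded_linear_scaleC] by (rule linear_diff)

lemma bounded_opsI:
  fixes T :: "'h::complex_hilbert \<Rightarrow> 'h"
  assumes "\<And>x y. T (x + y) = T x + T y" "\<And>c x. T (c *\<^sub>C x) = c *\<^sub>C T x"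
    "\<And>x. norm (T x) \<le> K * norm x"
  shows "T \<in> bounded_ops"
proof -
  have "bounded_linear T"
    by (rule bounded_linear_intro[where K = K]) (simp_all add: assms scaleR_scaleC mult.commute)
  then show ?thesis by (simp add: bounded_ops_def assms)
qed

lemma id_bounded_ops: "id \<in> bounded_ops"
  by (rule bounded_opsI[where K = 1]) auto

section \<open>Complex subspaces, orthogonal sums and projections\<close>

definition csubspace :: "'h::complex_vector set \<Rightarrow> bool" where
  "csubspace S \<longleftrightarrow> 0 \<in> S \<and> (\<forall>x\<in>S. \<forall>y\<in>S. x + y \<in> S) \<and> (\<forall>c. \<forall>x\<in>S. c *\<^sub>C x \<in> S)"

lemma csubspace_diff: "csubspace S \<Longrightarrow> x \<in> S \<Longrightarrow> y \<in> S \<Longrightarrow> x - y \<in> S"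
proof -
  assume S: "csubspace S" "x \<in> S" "y \<in> S"
  then have "x + (-1) *\<^sub>C y \<in> S" unfolding csubspace_def by blast
  then show ?thesis by (simp add: scaleC_minus1)
qed

lemma csubspace_add_set:
  assumes "csubspace A" "csubspace B"
  shows "csubspace {a + b |a b. a \<in> A \<and> b \<in> B}"
  unfolding csubspace_def
proof (intro conjI ballI allI)
  show "0 \<in> {a + b |a b. a \<in> A \<and> b \<in> B}"
    using assms by (auto simp: csubspace_def intro!: exI[of _ 0])
next
  fix x y assume "x \<in> {a + b |a b. a \<in> A \<and> b \<in> B}" "y \<in> {a + b |a b. a \<in> A \<and> b \<in> B}"
  then obtain a b c d where "x = a + b" "y = c + d" "a \<in> A" "b \<in> B" "c \<in> A" "d \<in> B" by blast
  then show "x + y \<in> {a + b |a b. a \<in> A \<and> b \<in> B}"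
    using assms
    by (intro CollectI exI[of _ "a + c"] exI[of _ "b + d"]) (simp add: csubspace_def algebra_simps)
next
  fix c x assume "x \<in> {a + b |a b. a \<in> A \<and> b \<in> B}"
  then obtain a b where "x = a + b" "a \<in> A" "b \<in> B" by blast
  then show "c *\<^sub>C x \<in> {a + b |a b. a \<in> A \<and> b \<in> B}"
    using assms
    by (intro CollectI exI[of _ "c *\<^sub>C a"] exI[of _ "c *\<^sub>C b"]) (simp add: csubspace_def scaleC_add_right)
qed

definition orth :: "'h::complex_inner set \<Rightarrow> 'h set" where
  "orth A = {x. \<forall>y\<in>A. cinner x y = 0}"

lemma csubspace_orth: "csubspace (orth A)"
  by (simp add: csubspace_def orth_def cinner_add_left cinner_scaleC_left)

lemma closed_orth: "closed (orth A)"
proof -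
  have "closed {x. cinner x y = 0}" for y :: 'a
    using linear_continuous_on[OF bounded_linear_cinner_left, of UNIV y] continuous_on_const
    by (rule closed_Collect_eq)
  moreover have "orth A = (\<Inter>y\<in>A. {x. cinner x y = 0})" by (auto simp: orth_def)
  ultimately show ?thesis by auto
qed

lemma norm_add_orthogonal:
  assumes "cinner x y = 0"
  shows "(norm (x + y))\<^sup>2 = (norm x)\<^sup>2 + (norm y)\<^sup>2"
proof -
  have "cinner y x = 0" using cinner_commute[of y x] assms by simp
  then have "inner x y = 0" "inner y x = 0" using assms by (simp_all add: inner_Re_cinner)
  then show ?thesis unfolding power2_norm_eq_inner inner_add_left inner_add_right by simp
qed

lemma norm_le_add_orthogonal: "cinner x y = 0 \<Longrightarrow> norm x \<le> norm (x + y)"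
  using norm_add_orthogonal[of x y] by (simp add: power2_le_imp_le)

text \<open>By Pythagoras the \<open>A\<close>-components of a convergent sequence are no further
  apart than its terms, so they form a Cauchy sequence; completeness supplies their limit, and the
  remainders converge in \<open>B\<close>.\<close>

lemma closed_orthogonal_sum:
  fixes A B :: "'h::complex_hilbert set"
  assumes A: "csubspace A" "closed A" and B: "csubspace B" "closed B"
    and orth: "\<And>a b. a \<in> A \<Longrightarrow> b \<in> B \<Longrightarrow> cinner a b = 0"
  shows "closed {a + b |a b. a \<in> A \<and> b \<in> B}"
  unfolding closed_sequential_limits
proof (intro allI impI, elim conjE)
  fix x l
  assume "\<forall>n. x n \<in> {a + b |a b. a \<in> A \<and> b \<in> B}" and lim: "x \<longlonglongrightarrow> l"
  then have "\<forall>n. \<exists>a b. x n = a + b \<and> a \<in> A \<and> b \<in> B" by auto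
  then obtain a b where ab: "\<And>n. x n = a n + b n" "\<And>n. a n \<in> A" "\<And>n. b n \<in> B" by metis
  have le: "dist (a m) (a n) \<le> dist (x m) (x n)" for m n
  proof -
    have "norm (a m - a n) \<le> norm ((a m - a n) + (b m - b n))"
      by (intro norm_le_add_orthogonal orth csubspace_diff A B ab)
    then show ?thesis by (simp add: dist_norm ab algebra_simps)
  qed
  have "Cauchy a"
  proof (rule metric_CauchyI)
    fix e :: real assume "e > 0"
    then obtain M where "\<And>m n. m \<ge> M \<Longrightarrow> n \<ge> M \<Longrightarrow> dist (x m) (x n) < e"
      using metric_CauchyD[OF LIMSEQ_imp_Cauchy[OF lim]] by blast
    then have "dist (a m) (a n) < e" if "m \<ge> M" "n \<ge> M" for m n
      using that le[of m n] by (meson le_less_trans)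
    then show "\<exists>M. \<forall>m\<ge>M. \<forall>n\<ge>M. dist (a m) (a n) < e" by blast
  qed
  then obtain p where p: "a \<longlonglongrightarrow> p" using Cauchy_convergent[of a] unfolding convergent_def by fast
  have "p \<in> A" by (rule closed_sequentially[OF A(2) ab(2) p])
  moreover have "(\<lambda>n. x n - a n) \<longlonglongrightarrow> l - p" by (intro tendsto_diff lim p)
  then have "l - p \<in> B" by (rule closed_sequentially[OF B(2), rotated]) (simp add: ab)
  ultimately show "l \<in> {a + b |a b. a \<in> A \<and> b \<in> B}"
    by (intro CollectI exI[of _ p] exI[of _ "l - p"]) simp
qed

text \<open>Orthogonality makes the splitting \<open>x = a + b\<close> unique, which gives linearity
  of the choice of \<open>a\<close>; Pythagoras gives contractivity. That the sum is the whole space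
  is a hypothesis because it will be verified on elementary tensors.\<close>

lemma ex_orthogonal_projection:
  fixes A B :: "'h::complex_hilbert set"
  assumes A: "csubspace A" and B: "csubspace B"
    and orth: "\<And>a b. a \<in> A \<Longrightarrow> b \<in> B \<Longrightarrow> cinner a b = 0"
    and sum: "{a + b |a b. a \<in> A \<and> b \<in> B} = UNIV"
  obtains P where "P \<in> bounded_ops" "\<And>a. a \<in> A \<Longrightarrow> P a = a" "\<And>b. b \<in> B \<Longrightarrow> P b = 0"
    "\<And>x. norm (P x) \<le> norm x"
proof -
  have uniq: "a = a'" if "a \<in> A" "x - a \<in> B" "a' \<in> A" "x - a' \<in> B" for x a a'
  proof -
    have "a - a' \<in> A" "(x - a') - (x - a) \<in> B"
      using csubspace_diff[OF A that(1,3)] csubspace_diff[OF B that(4,2)] by simp_all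
    then have "cinner (a - a') (a - a') = 0" by (intro orth) simp_all
    then show ?thesis by (simp add: cinner_self)
  qed
  have "\<exists>a. a \<in> A \<and> x - a \<in> B" for x
  proof -
    have "x \<in> {a + b |a b. a \<in> A \<and> b \<in> B}" using sum by simp
    then obtain a b where "x = a + b" "a \<in> A" "b \<in> B" by blast
    then show ?thesis by (intro exI[of _ a]) simp
  qed
  then obtain P where P: "\<And>x. P x \<in> A" "\<And>x. x - P x \<in> B" by metis
  have le: "norm (P x) \<le> norm x" for x
    using norm_le_add_orthogonal[OF orth[OF P(1) P(2)], of x x] by simp
  have "P (x + y) = P x + P y" for x y
  proof (rule uniq[of _ "x + y"])
    have "(x - P x) + (y - P y) \<in> B" using B P(2) by (simp add: csubspace_def)
    then show "x + y - (P x + P y) \<in> B" by (simp add: algebra_simps)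
  qed (use P A in \<open>auto simp: csubspace_def\<close>)
  moreover have "P (c *\<^sub>C x) = c *\<^sub>C P x" for c x
  proof (rule uniq[of _ "c *\<^sub>C x"])
    have "c *\<^sub>C (x - P x) \<in> B" using B P(2) by (simp add: csubspace_def)
    then show "c *\<^sub>C x - c *\<^sub>C P x \<in> B" by (simp add: scaleC_diff_right)
  qed (use P A in \<open>auto simp: csubspace_def\<close>)
  ultimately have "P \<in> bounded_ops" using le by (intro bounded_opsI[where K = 1]) auto
  moreover have "P a = a" if "a \<in> A" for a
    using P that B by (intro uniq[of _ a]) (auto simp: csubspace_def)
  moreover have "P b = 0" if "b \<in> B" for b
    using P that A by (intro uniq[of _ b]) (auto simp: csubspace_def)
  ultimately show ?thesis using that le by blast
qed

text \<open>The operator |w><w|, which is the orthogonal projection onto the line of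
  \<open>w\<close> when \<open>w\<close> is a unit vector.\<close>

definition rank_one :: "'h::complex_inner \<Rightarrow> 'h \<Rightarrow> 'h" where
  "rank_one w x = cinner x w *\<^sub>C w"

lemma rank_one_bounded_ops: "rank_one (w :: 'h::complex_hilbert) \<in> bounded_ops"
proof (rule bounded_opsI)
  show "norm (rank_one w x) \<le> (norm w)\<^sup>2 * norm x" for x
    using mult_right_mono[OF cmod_cinner_le[of x w], of "norm w"]
    by (simp add: rank_one_def norm_scaleC power2_eq_square mult_ac)
qed (simp_all add: rank_one_def cinner_add_left scaleC_add_left cinner_scaleC_left scaleC_scaleC)

section \<open>Multilinearity and coordinates of elementary tensors\<close>

lemma elementary_update_add:
  assumes "i < n"
  shows "elementary_tensor n (\<xi>(i := a + b)) =
    elementary_tensor n (\<xi>(i := a)) + elementary_tensor n (\<xi>(i := b))"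
proof -
  \<comment> \<open>Only the factor at position \<open>i\<close> depends on the new entry
    \<open>v\<close>, and it is additive in \<open>v\<close>.\<close>
  have "(\<Prod>j<n. Rep_ell2 ((\<xi>(i := v)) j) (xs ! j)) =
      Rep_ell2 v (xs ! i) * (\<Prod>j\<in>{..<n} - {i}. Rep_ell2 (\<xi> j) (xs ! j))" for v xs
    using assms by (subst prod.remove[of _ i]) (auto intro!: prod.cong)
  then show ?thesis
    by (intro Rep_ell2_inject[THEN iffD1])
       (simp add: fun_eq_iff Rep_elementary_tensor plus_ell2.rep_eq distrib_right del: fun_upd_apply)
qed

lemma elementary_scale:
  "elementary_tensor n (\<lambda>j. c j *\<^sub>C \<xi> j) = (\<Prod>j<n. c j) *\<^sub>C elementary_tensor n \<xi>"
  by (intro Rep_ell2_inject[THEN iffD1])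
     (simp add: fun_eq_iff Rep_elementary_tensor scaleC_ell2.rep_eq prod.distrib)

lemma elementary_basis:
  "length xs = n \<Longrightarrow> elementary_tensor n (\<lambda>i. ell2_basis (xs ! i)) = ell2_basis xs"
  by (intro Rep_ell2_inject[THEN iffD1] ext)
     (simp add: Rep_elementary_tensor Rep_basis list_eq_iff_nth_eq prod_zero_iff; fastforce)

lemma ell2_finite_approximation:
  assumes "e > 0"
  obtains F where "finite F" "norm (f - (\<Sum>s\<in>F. Rep_ell2 f s *\<^sub>C ell2_basis s)) < e"
proof -
  \<comment> \<open>Halving \<open>e\<close> turns the non-strict bound obtained below into a strict
    one.\<close>
  define d where "d = e / 2"
  have d: "d > 0" using assms by (simp add: d_def)
  obtain F where F: "finite F" "dist (\<Sum>s\<in>F. (cmod (Rep_ell2 f s))\<^sup>2) ((norm f)\<^sup>2) \<le> d\<^sup>2"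
    using has_sum_finite_approximation[OF norm_ell2_has_sum[of f], of "d\<^sup>2"] d by auto
  have R: "Rep_ell2 (\<Sum>s\<in>F. Rep_ell2 f s *\<^sub>C ell2_basis s) t = (if t \<in> F then Rep_ell2 f t else 0)" for t
  proof -
    have "Rep_ell2 (\<Sum>s\<in>F. Rep_ell2 f s *\<^sub>C ell2_basis s) t
        = (\<Sum>s\<in>F. Rep_ell2 (Rep_ell2 f s *\<^sub>C ell2_basis s) t)"
      using F(1) by (induction F) (simp_all add: zero_ell2.rep_eq plus_ell2.rep_eq)
    then show ?thesis using F(1) by (simp add: scaleC_ell2.rep_eq Rep_basis if_distrib cong: if_cong)
  qed
  have "norm (f - (\<Sum>s\<in>F. Rep_ell2 f s *\<^sub>C ell2_basis s)) \<le> d"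
  proof (rule norm_ell2_le)
    fix G :: "'a set" assume G: "finite G"
    have "(\<Sum>i\<in>G. (cmod (Rep_ell2 (f - (\<Sum>s\<in>F. Rep_ell2 f s *\<^sub>C ell2_basis s)) i))\<^sup>2)
        = (\<Sum>i\<in>G - F. (cmod (Rep_ell2 f i))\<^sup>2)"
      using G by (intro sum.mono_neutral_cong_right) (auto simp: minus_ell2.rep_eq R)
    also have "\<dots> = (\<Sum>i\<in>G \<union> F. (cmod (Rep_ell2 f i))\<^sup>2) - (\<Sum>i\<in>F. (cmod (Rep_ell2 f i))\<^sup>2)"
      using sum.subset_diff[of F "G \<union> F" "\<lambda>i. (cmod (Rep_ell2 f i))\<^sup>2"] G F(1)
      by (simp add: Un_Diff)
    also have "\<dots> \<le> (norm f)\<^sup>2 - (\<Sum>i\<in>F. (cmod (Rep_ell2 f i))\<^sup>2)"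
      using sum_le_norm_ell2[of "G \<union> F" f] G F(1) by simp
    also have "\<dots> \<le> d\<^sup>2" using F(2) by (simp add: dist_real_def)
    finally show "(\<Sum>i\<in>G. (cmod (Rep_ell2 (f - (\<Sum>s\<in>F. Rep_ell2 f s *\<^sub>C ell2_basis s)) i))\<^sup>2) \<le> d\<^sup>2" .
  qed (use d in simp)
  then show ?thesis using that[OF F(1)] assms by (simp add: d_def)
qed

text \<open>Together with totality of the elementary tensors, this shows that bounded operators
  agreeing on those tensors coincide.\<close>

lemma csubspace_eqI:
  assumes "X \<in> bounded_ops" "Y \<in> bounded_ops"
  shows "csubspace {x. X x = Y x}" "closed {x. X x = Y x}"
proof -
  interpret X: bounded_linear X using assms(1) by (simp add: bounded_ops_def)
  interpret Y: bounded_linear Y using assms(2) by (simp add: bounded_ops_def)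
  show "csubspace {x. X x = Y x}"
    using assms by (simp add: csubspace_def X.zero Y.zero X.add Y.add bounded_ops_def)
  show "closed {x. X x = Y x}"
    by (intro closed_Collect_eq linear_continuous_on X.bounded_linear_axioms Y.bounded_linear_axioms)
qed

lemma bounded_ops_comp: "S \<in> bounded_ops \<Longrightarrow> T \<in> bounded_ops \<Longrightarrow> S \<circ> T \<in> bounded_ops"
  using bounded_linear_compose[of S T] by (simp add: bounded_ops_def o_def)

section \<open>Operators on infinite tensor products\<close>

text \<open>For a unit vector \<open>w\<close> this family describes the projection that restricts
  the \<open>i\<close>-th factor to the line of \<open>w\<close>. The whole argument tests the
  product action on such families.\<close>

definition slot :: "nat \<Rightarrow> 'g ell2 \<Rightarrow> nat \<Rightarrow> 'g ell2 \<Rightarrow> 'g ell2" where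
  "slot i w = (\<lambda>_. id)(i := rank_one w)"

lemma slot_bounded_ops: "slot i w j \<in> bounded_ops"
  by (simp add: slot_def id_bounded_ops rank_one_bounded_ops)

locale infinite_tensor =
  fixes \<phi> :: "nat \<Rightarrow> 'g ell2" and J :: "nat \<Rightarrow> 'g list ell2 \<Rightarrow> 'k::complex_hilbert"
  assumes unit: "norm (\<phi> i) = 1"
    and itp: "infinite_tensor_product \<phi> J"
begin

lemma J_add: "\<psi> \<in> tensor_power n \<Longrightarrow> \<psi>' \<in> tensor_power n \<Longrightarrow> J n (\<psi> + \<psi>') = J n \<psi> + J n \<psi>'"
  and J_scale: "\<psi> \<in> tensor_power n \<Longrightarrow> J n (c *\<^sub>C \<psi>) = c *\<^sub>C J n \<psi>"
  and J_norm: "\<psi> \<in> tensor_power n \<Longrightarrow> norm (J n \<psi>) = norm \<psi>"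
  and J_step: "\<psi> \<in> tensor_power n \<Longrightarrow> J (Suc n) (tensor_right \<psi> (\<phi> n)) = J n \<psi>"
  and J_dense: "closure (\<Union>n. J n ` tensor_power n) = UNIV"
  using itp unfolding infinite_tensor_product_def by blast+

text \<open>Polarization: norms determine the real inner product, and the imaginary part of the
  complex one is a real inner product with \<open>\<i> *\<^sub>C y\<close>.\<close>

lemma J_cinner:
  assumes "\<psi> \<in> tensor_power n" "\<psi>' \<in> tensor_power n"
  shows "cinner (J n \<psi>) (J n \<psi>') = cinner \<psi> \<psi>'"
proof -
  have tp: "\<psi> + \<eta> \<in> tensor_power n" "c *\<^sub>C \<eta> \<in> tensor_power n" if "\<eta> \<in> tensor_power n" for \<eta> c
    using assms that by (simp_all add: tensor_power_def plus_ell2.rep_eq scaleC_ell2.rep_eq)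
  have re: "inner (J n \<psi>) (J n \<eta>) = inner \<psi> \<eta>" if "\<eta> \<in> tensor_power n" for \<eta>
    unfolding dot_norm using assms that by (simp add: J_norm tp flip: J_add)
  have im: "Im (cinner x y) = inner x (\<i> *\<^sub>C y)" for x y :: "'h::complex_inner"
    by (simp add: inner_Re_cinner cinner_scaleC_right)
  have "Im (cinner (J n \<psi>) (J n \<psi>')) = Im (cinner \<psi> \<psi>')"
    unfolding im using assms re[OF tp(2)] by (simp add: J_scale)
  then show ?thesis
    using re[OF assms(2)] by (simp add: complex_eq_iff inner_Re_cinner)
qed

section \<open>Elementary tensors at different levels, and their totality\<close>

definition E :: "nat \<Rightarrow> (nat \<Rightarrow> 'g ell2) \<Rightarrow> 'k" where
  "E n \<xi> = J n (elementary_tensor n \<xi>)"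

text \<open>The factors from \<open>n\<close> on are those appended by the connecting isometries, so
  this family represents \<open>E n \<xi>\<close> at every later level.\<close>

definition pad :: "nat \<Rightarrow> (nat \<Rightarrow> 'g ell2) \<Rightarrow> nat \<Rightarrow> 'g ell2" where
  "pad n \<xi> j = (if j < n then \<xi> j else \<phi> j)"

lemma E_cong: "(\<And>j. j < n \<Longrightarrow> \<xi> j = \<zeta> j) \<Longrightarrow> E n \<xi> = E n \<zeta>"
  unfolding E_def by (metis elementary_cong)

lemma E_pad:
  assumes "n \<le> m"
  shows "E n \<xi> = E m (pad n \<xi>)"
  using assms
proof (induction m rule: dec_induct)
  case base show ?case by (rule E_cong) (simp add: pad_def)
next
  case (step m)
  have "E (Suc m) (pad n \<xi>) = J (Suc m) (tensor_right (elementary_tensor m (pad n \<xi>)) (\<phi> m))"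
    using step by (simp add: E_def elementary_Suc pad_def)
  then show ?case using step by (simp add: J_step tensor_power_elementary) (simp add: E_def)
qed

lemma E_cinner: "cinner (E n \<xi>) (E n \<zeta>) = (\<Prod>j<n. cinner (\<xi> j) (\<zeta> j))"
  by (simp add: E_def J_cinner tensor_power_elementary cinner_elementary)

lemma E_scale: "E n (\<lambda>j. c j *\<^sub>C \<xi> j) = (\<Prod>j<n. c j) *\<^sub>C E n \<xi>"
  by (simp add: E_def elementary_scale J_scale tensor_power_elementary)

lemma E_update_add: "i < n \<Longrightarrow> E n (\<xi>(i := a + b)) = E n (\<xi>(i := a)) + E n (\<xi>(i := b))"
  unfolding E_def
  by (simp only: elementary_update_add J_add tensor_power_elementary)

text \<open>Both tensors are raised to a common level. Position \<open>i\<close> lies below both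
  original levels, so padding leaves it alone and the product of inner products contains a zero
  factor.\<close>

lemma E_orthogonal:
  assumes "i < n" "i < m" "cinner (\<xi> i) (\<zeta> i) = 0"
  shows "cinner (E n \<xi>) (E m \<zeta>) = 0"
proof -
  have "cinner (E n \<xi>) (E m \<zeta>) = cinner (E (max n m) (pad n \<xi>)) (E (max n m) (pad m \<zeta>))"
    using E_pad[of n "max n m"] E_pad[of m "max n m"] by simp
  also have "\<dots> = 0"
    unfolding E_cinner using assms by (auto simp: pad_def intro!: bexI[of _ i])
  finally show ?thesis .
qed

text \<open>Standard basis vectors of a tensor power are elementary, finite coordinate sums
  approximate every vector of it, and the isometric images of the tensor powers are dense. The
  threshold \<open>N\<close> allows checking only levels beyond a given factor.\<close>

lemma elementary_total:
  assumes S: "csubspace S" "closed S" and E: "\<And>n \<xi>. N \<le> n \<Longrightarrow> E n \<xi> \<in> S"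
  shows "S = UNIV"
proof -
  have ES: "E n \<xi> \<in> S" for n \<xi>
    using E[of "max n N"] E_pad[of n "max n N"] by simp
  have JS: "J n \<psi> \<in> S" if \<psi>: "\<psi> \<in> tensor_power n" for n \<psi>
  proof -
    let ?t = "\<lambda>s. Rep_ell2 \<psi> s *\<^sub>C ell2_basis s"
    have tp0: "0 \<in> tensor_power n" by (simp add: tensor_power_def zero_ell2.rep_eq)
    have J0: "J n 0 = 0" using J_norm[OF tp0] by simp
    have t: "?t s \<in> tensor_power n \<and> J n (?t s) \<in> S" for s
    proof (cases "length s = n")
      case True
      have "ell2_basis s \<in> tensor_power n" using True by (auto simp: tensor_power_def Rep_basis)
      moreover have "J n (ell2_basis s) \<in> S"
        using ES[of n "\<lambda>i. ell2_basis (s ! i)"] elementary_basis[OF True] by (simp add: E_def)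
      ultimately show ?thesis
        using S(1) by (simp add: J_scale csubspace_def) (simp add: tensor_power_def scaleC_ell2.rep_eq)
    next
      case False
      then show ?thesis
        using \<psi> S(1) by (simp add: tensor_power_def csubspace_def J0 zero_ell2.rep_eq)
    qed
    have sum: "sum ?t F \<in> tensor_power n \<and> J n (sum ?t F) \<in> S" if "finite F" for F
      using that
    proof induction
      case empty then show ?case using S(1) tp0 by (simp add: J0 csubspace_def)
    next
      case (insert s F)
      moreover have "?t s + sum ?t F \<in> tensor_power n"
        using insert t[of s] by (simp add: tensor_power_def plus_ell2.rep_eq)
      ultimately show ?case using t[of s] S(1) by (simp add: J_add csubspace_def)
    qed
    have "\<exists>y\<in>S. dist y (J n \<psi>) < e" if e: "e > 0" for e
    proof -
      obtain F where F: "finite F" "norm (\<psi> - sum ?t F) < e"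
        using ell2_finite_approximation[OF e] by blast
      have "\<psi> - sum ?t F \<in> tensor_power n"
        using \<psi> sum[OF F(1)] by (simp add: tensor_power_def minus_ell2.rep_eq)
      then have "norm (J n (\<psi> - sum ?t F)) < e" using F J_norm by simp
      moreover have "J n (\<psi> - sum ?t F) = J n \<psi> - J n (sum ?t F)"
        using J_add[OF \<open>\<psi> - sum ?t F \<in> _\<close> conjunct1[OF sum[OF F(1)]]] by (simp add: algebra_simps)
      ultimately show ?thesis
        using sum[OF F(1)] by (intro bexI[of _ "J n (sum ?t F)"]) (auto simp: dist_norm norm_minus_commute)
    qed
    then show ?thesis using closed_approachable[OF S(2)] by blast
  qed
  have "closure (\<Union>n. J n ` tensor_power n) \<subseteq> S"
    using JS S(2) by (intro closure_minimal) auto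
  then show ?thesis using J_dense by auto
qed

text \<open>The bound is uniform in \<open>i\<close>, so the vectors with convergence to 0 form a
  closed subspace; totality then reduces the claim to elementary tensors.\<close>

lemma seminorms_tendsto_0:
  fixes p :: "nat \<Rightarrow> 'k \<Rightarrow> real"
  assumes nonneg: "\<And>i x. 0 \<le> p i x" and add: "\<And>i x y. p i (x + y) \<le> p i x + p i y"
    and scale: "\<And>i c x. p i (c *\<^sub>C x) \<le> cmod c * p i x" and bound: "\<And>i x. p i x \<le> C * norm x"
    and E: "\<And>n \<xi>. (\<lambda>i. p i (E n \<xi>)) \<longlonglongrightarrow> 0"
  shows "(\<lambda>i. p i x) \<longlonglongrightarrow> 0"
proof -
  have sub: "f \<longlonglongrightarrow> 0" if "\<And>i. f i \<le> g i" "\<And>i. 0 \<le> f i" "g \<longlonglongrightarrow> 0" for f g :: "nat \<Rightarrow> real"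
    by (rule tendsto_sandwich[OF _ _ tendsto_const that(3)]) (simp_all add: that)
  have cs: "csubspace {x. (\<lambda>i. p i x) \<longlonglongrightarrow> 0}"
    unfolding csubspace_def
  proof (safe intro!: CollectI)
    show "(\<lambda>i. p i 0) \<longlonglongrightarrow> 0"
      by (rule sub[where g = "\<lambda>_. 0"]) (use bound[of _ 0] nonneg in auto)
  next
    fix x y assume "(\<lambda>i. p i x) \<longlonglongrightarrow> 0" "(\<lambda>i. p i y) \<longlonglongrightarrow> 0"
    then show "(\<lambda>i. p i (x + y)) \<longlonglongrightarrow> 0"
      by (intro sub[OF add nonneg]) (rule tendsto_add_zero)
  next
    fix c x assume "(\<lambda>i. p i x) \<longlonglongrightarrow> 0"
    then show "(\<lambda>i. p i (c *\<^sub>C x)) \<longlonglongrightarrow> 0"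
      by (intro sub[OF scale nonneg]) (rule tendsto_mult_right_zero)
  qed
  have cl: "closed {x. (\<lambda>i. p i x) \<longlonglongrightarrow> 0}"
    unfolding closure_subset_eq[symmetric]
  proof (rule subsetI, rule CollectI)
    fix x assume "x \<in> closure {x. (\<lambda>i. p i x) \<longlonglongrightarrow> 0}"
    then have x: "\<forall>e>0. \<exists>y\<in>{x. (\<lambda>i. p i x) \<longlonglongrightarrow> 0}. dist y x < e"
      by (simp only: closure_approachable)
    show "(\<lambda>i. p i x) \<longlonglongrightarrow> 0"
    proof (rule LIMSEQ_I)
      fix e :: real assume e: "e > 0"
      \<comment> \<open>\<open>C\<close> need not be positive, and the division below needs a
        positive bound.\<close>
      define D where "D = max C 1"
      have D: "D > 0" "C \<le> D" by (simp_all add: D_def)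
      then obtain y where y: "(\<lambda>i. p i y) \<longlonglongrightarrow> 0" "dist y x < e / (2 * D)"
        using x e by (auto dest!: spec[of _ "e / (2 * D)"])
      obtain M where M: "\<And>i. i \<ge> M \<Longrightarrow> norm (p i y - 0) < e / 2"
        using LIMSEQ_D[OF y(1), of "e / 2"] e by auto
      have "norm (p i x - 0) < e" if "i \<ge> M" for i
      proof -
        have "p i x \<le> p i (x - y) + p i y" using add[of i "x - y" y] by simp
        also have "p i (x - y) \<le> D * norm (x - y)"
          using bound[of i "x - y"] mult_right_mono[OF D(2), of "norm (x - y)"] by simp
        also have "D * norm (x - y) < e / 2"
          using y(2) D by (simp add: dist_norm norm_minus_commute field_simps)
        finally show ?thesis using M[OF that] nonneg[of i x] by simp
      qed
      then show "\<exists>M. \<forall>i\<ge>M. norm (p i x - 0) < e" by blast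
    qed
  qed
  have "x \<in> {x. (\<lambda>i. p i x) \<longlonglongrightarrow> 0}"
    using elementary_total[OF cs cl, of 0] E by blast
  then show ?thesis by simp
qed

section \<open>Projections acting in one tensor factor\<close>

lemma slot_op_E:
  assumes "is_tensor_op J (slot i w) X" "i < n"
  shows "X (E n \<xi>) = E n (\<xi>(i := rank_one w (\<xi> i)))"
proof -
  have "(\<lambda>j. slot i w j (\<xi> j)) = \<xi>(i := rank_one w (\<xi> i))" by (auto simp: slot_def)
  moreover have "\<forall>j\<ge>n. slot i w j = id" using assms(2) by (simp add: slot_def)
  ultimately show ?thesis using assms(1) unfolding is_tensor_op_def E_def by metis
qed

text \<open>The operator arises as an orthogonal projection. Splitting the \<open>i\<close>-th entry
  along \<open>w\<close> places every elementary tensor beyond level \<open>i\<close> in the closed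
  orthogonal sum \<open>A + B\<close>, which is therefore everything.\<close>

lemma ex_slot_op:
  assumes w: "norm w = 1"
  obtains X where "is_tensor_op J (slot i w) X" "\<And>x. norm (X x) \<le> norm x"
proof -
  have ww: "cinner w w = 1" using w by (simp add: cinner_self)
  \<comment> \<open>\<open>B0\<close> is only a set of generators; its complement \<open>A\<close>
    and double complement \<open>B\<close> are closed subspaces, with \<open>B0\<close> contained in
    \<open>B\<close>.\<close>
  define B0 where "B0 = {E n \<xi> |n \<xi>. i < n \<and> cinner (\<xi> i) w = 0}"
  define A where "A = orth B0"
  define B where "B = orth A"
  have AB: "cinner a b = 0" if "a \<in> A" "b \<in> B" for a b
    using that cinner_commute[of a b] by (simp add: B_def orth_def)
  have EA: "E n \<xi> \<in> A" if "i < n" "\<xi> i = c *\<^sub>C w" for n \<xi> c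
    unfolding A_def orth_def B0_def
  proof safe
    fix m \<zeta> assume "i < m" "cinner (\<zeta> i) w = 0"
    then show "cinner (E n \<xi>) (E m \<zeta>) = 0"
      using that cinner_commute[of w "\<zeta> i"]
      by (intro E_orthogonal[of i]) (simp_all add: cinner_scaleC_left)
  qed
  have EB: "E n \<xi> \<in> B" if "i < n" "cinner (\<xi> i) w = 0" for n \<xi>
  proof -
    have "E n \<xi> \<in> B0" using that by (auto simp: B0_def)
    then show ?thesis
      using cinner_commute[of "E n \<xi>"] by (auto simp: B_def A_def orth_def)
  qed
  have dec: "E n \<xi> = E n (\<xi>(i := rank_one w (\<xi> i))) + E n (\<xi>(i := \<xi> i - rank_one w (\<xi> i)))"
    if "i < n" for n \<xi>
    using E_update_add[OF that, of \<xi> "rank_one w (\<xi> i)" "\<xi> i - rank_one w (\<xi> i)"] by simp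
  have decA: "E n (\<xi>(i := rank_one w (\<xi> i))) \<in> A" if "i < n" for n \<xi>
    by (rule EA[OF that]) (simp add: rank_one_def)
  have decB: "E n (\<xi>(i := \<xi> i - rank_one w (\<xi> i))) \<in> B" if "i < n" for n \<xi>
    by (rule EB[OF that]) (simp add: rank_one_def cinner_diff_left cinner_scaleC_left ww)
  have cs: "csubspace A" "csubspace B" "closed A" "closed B"
    by (simp_all add: A_def B_def csubspace_orth closed_orth)
  have "{a + b |a b. a \<in> A \<and> b \<in> B} = UNIV"
  proof (rule elementary_total)
    show "csubspace {a + b |a b. a \<in> A \<and> b \<in> B}" by (intro csubspace_add_set cs)
    show "closed {a + b |a b. a \<in> A \<and> b \<in> B}" by (intro closed_orthogonal_sum cs AB)
    show "E n \<xi> \<in> {a + b |a b. a \<in> A \<and> b \<in> B}" if "Suc i \<le> n" for n \<xi>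
      using dec[of n \<xi>] decA[of n \<xi>] decB[of n \<xi>] that by auto
  qed
  then obtain P where P: "P \<in> bounded_ops" "\<And>a. a \<in> A \<Longrightarrow> P a = a" "\<And>b. b \<in> B \<Longrightarrow> P b = 0"
    "\<And>x. norm (P x) \<le> norm x"
    using ex_orthogonal_projection[OF cs(1,2) AB] by blast
  have PE: "P (E n \<xi>) = E n (\<xi>(i := rank_one w (\<xi> i)))" if "i < n" for n \<xi>
  proof -
    interpret P: bounded_linear P using P(1) by (simp add: bounded_ops_def)
    show ?thesis
      using dec[OF that, of \<xi>] P(2)[OF decA[OF that, of \<xi>]] P(3)[OF decB[OF that, of \<xi>]]
      by (metis P.add add.right_neutral)
  qed
  have "P (J n (elementary_tensor n \<xi>)) = J n (elementary_tensor n (\<lambda>j. slot i w j (\<xi> j)))"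
    if id: "\<forall>j\<ge>n. slot i w j = id" for n \<xi>
  proof (cases "i < n")
    case True
    have "(\<lambda>j. slot i w j (\<xi> j)) = \<xi>(i := rank_one w (\<xi> i))" by (auto simp: slot_def)
    then show ?thesis using PE[OF True, of \<xi>] by (simp add: E_def)
  next
    case False
    \<comment> \<open>Degenerate case: a level \<open>n \<le> i\<close> is allowed only if |w><w| is
      the identity. Raising the tensor to level \<open>Suc i\<close> then shows that
      \<open>P\<close> fixes it.\<close>
    then have "slot i w i = id" using id by auto
    then have "rank_one w = id" by (simp add: slot_def)
    then have "P (E n \<xi>) = E n \<xi>"
      using False E_pad[of n "Suc i" \<xi>] PE[of "Suc i" "pad n \<xi>"] by simp
    moreover have "E n (\<lambda>j. slot i w j (\<xi> j)) = E n \<xi>"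
      using False by (intro E_cong) (auto simp: slot_def)
    ultimately show ?thesis by (simp add: E_def)
  qed
  moreover have "finite {j. slot i w j \<noteq> id}"
    by (rule finite_subset[of _ "{i}"]) (auto simp: slot_def)
  ultimately have "is_tensor_op J (slot i w) P" using P(1) by (simp add: is_tensor_op_def)
  then show ?thesis using that P(4) by blast
qed

text \<open>The values on elementary tensors determine a bounded operator, so \<open>X\<close> is
  the contraction constructed before.\<close>

lemma slot_op_contraction:
  assumes "norm w = 1" "is_tensor_op J (slot i w) X"
  shows "norm (X x) \<le> norm x"
proof -
  obtain X' where X': "is_tensor_op J (slot i w) X'" "\<And>x. norm (X' x) \<le> norm x"
    using ex_slot_op[OF assms(1)] by blast
  have "X \<in> bounded_ops" "X' \<in> bounded_ops" using assms X' by (auto simp: is_tensor_op_def)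
  then have "{x. X x = X' x} = UNIV"
    using slot_op_E[OF assms(2)] slot_op_E[OF X'(1)]
    by (intro elementary_total[OF csubspace_eqI, where N = "Suc i"]) simp_all
  then have "X x = X' x" by blast
  then show ?thesis using X'(2) by simp
qed

section \<open>The projection onto the vacuum vector\<close>

definition vacuum :: 'k where "vacuum = E 0 \<phi>"

text \<open>The empty product is padded with reference vectors, so it represents the infinite
  product of all of them.\<close>

lemma vacuum_eq: "vacuum = E n \<phi>"
proof -
  have "pad 0 \<phi> = \<phi>" by (auto simp: pad_def)
  then show ?thesis using E_pad[of 0 n \<phi>] by (simp add: vacuum_def)
qed

lemma norm_vacuum: "norm vacuum = 1"
proof -
  have "complex_of_real ((norm vacuum)\<^sup>2) = 1"
    unfolding cinner_self[symmetric] by (simp add: vacuum_def E_cinner)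
  then show ?thesis
    by (metis of_real_eq_1_iff norm_ge_zero power2_eq_1_iff one_neq_neg_one le_minus_one_simps(3))
qed

text \<open>On an elementary tensor the sequence is eventually constant: once all its nontrivial
  factors have been projected, the product of the coefficients is the inner product with the vacuum.
  Contractivity of the \<open>P n\<close> extends the limit to all vectors.\<close>

lemma slot_projections_tendsto_vacuum:
  assumes X: "\<And>i. is_tensor_op J (slot i (\<phi> i)) (X i)"
    and P0: "P 0 = id" and P_Suc: "\<And>n. P (Suc n) = X n \<circ> P n"
  shows "(\<lambda>n. P n x) \<longlonglongrightarrow> rank_one vacuum x"
proof -
  have Pb: "P n \<in> bounded_ops" for n
    using X by (induction n) (auto simp: P0 P_Suc id_bounded_ops is_tensor_op_def intro: bounded_ops_comp)
  have Pn: "norm (P n x) \<le> norm x" for n x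
  proof (induction n)
    case (Suc n)
    then show ?case using slot_op_contraction[OF unit X, of n "P n x"] by (simp add: P_Suc)
  qed (simp add: P0)
  \<comment> \<open>Induction on the number \<open>k\<close> of factors already projected, at a
    fixed level \<open>n\<close>.\<close>
  have PE: "P k (E n \<xi>) = E n (\<lambda>j. if j < k then rank_one (\<phi> j) (\<xi> j) else \<xi> j)" if "k \<le> n" for k n \<xi>
    using that
  proof (induction k)
    case (Suc k)
    then show ?case
      by (simp add: P_Suc slot_op_E[OF X]) (rule E_cong, auto simp: less_Suc_eq)
  qed (simp add: P0)
  have PQ: "P n (E n \<xi>) = rank_one vacuum (E n \<xi>)" for n \<xi>
  proof -
    have "P n (E n \<xi>) = E n (\<lambda>j. cinner (\<xi> j) (\<phi> j) *\<^sub>C \<phi> j)"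
      using PE[of n n \<xi>] by simp (rule E_cong, simp add: rank_one_def)
    also have "\<dots> = (\<Prod>j<n. cinner (\<xi> j) (\<phi> j)) *\<^sub>C E n \<phi>" by (rule E_scale)
    finally show ?thesis unfolding vacuum_eq[of n] by (simp add: rank_one_def E_cinner)
  qed
  have add: "P n (x + y) = P n x + P n y" and scale: "P n (c *\<^sub>C x) = c *\<^sub>C P n x" for n x y c
    using Pb[of n] by (auto simp: bounded_ops_def linear_simps)
  have Qadd: "rank_one vacuum (x + y) = rank_one vacuum x + rank_one vacuum y"
    and Qscale: "rank_one vacuum (c *\<^sub>C x) = c *\<^sub>C rank_one vacuum x" for x y c
    by (simp_all add: rank_one_def cinner_add_left scaleC_add_left cinner_scaleC_left scaleC_scaleC)
  have "(\<lambda>n. norm (P n x - rank_one vacuum x)) \<longlonglongrightarrow> 0"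
  proof (rule seminorms_tendsto_0[where p = "\<lambda>n x. norm (P n x - rank_one vacuum x)" and C = 2])
    show "norm (P n (x + y) - rank_one vacuum (x + y)) \<le>
        norm (P n x - rank_one vacuum x) + norm (P n y - rank_one vacuum y)" for n x y
      unfolding add Qadd add_diff_add by (rule norm_triangle_ineq)
    show "norm (P n (c *\<^sub>C x) - rank_one vacuum (c *\<^sub>C x)) \<le>
        cmod c * norm (P n x - rank_one vacuum x)" for n x c
      by (simp add: scale Qscale norm_scaleC flip: scaleC_diff_right)
    show "norm (P n x - rank_one vacuum x) \<le> 2 * norm x" for n x
    proof -
      have "norm (rank_one vacuum x) \<le> norm x"
        using cmod_cinner_le[of x vacuum] by (simp add: rank_one_def norm_scaleC norm_vacuum)
      then show ?thesis
        using Pn[of n x] norm_triangle_ineq4[of "P n x" "rank_one vacuum x"] by simp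
    qed
    show "(\<lambda>n. norm (P n (E m \<xi>) - rank_one vacuum (E m \<xi>))) \<longlonglongrightarrow> 0" for m \<xi>
    proof (rule tendsto_eventually, rule eventually_sequentiallyI)
      fix n assume "m \<le> n"
      then show "norm (P n (E m \<xi>) - rank_one vacuum (E m \<xi>)) = 0"
        using PQ[of n "pad m \<xi>"] by (simp add: E_pad)
    qed
  qed simp
  then show ?thesis by (simp add: tendsto_norm_zero_iff Lim_null[of "\<lambda>n. P n x"])
qed

abbreviation M :: "('k \<Rightarrow> 'k) set" where
  "M \<equiv> von_neumann_tensor_product J (\<lambda>_. bounded_ops)"

lemma tensor_op_in_M: "is_tensor_op J (slot i w) X \<Longrightarrow> X \<in> M"
  unfolding von_neumann_tensor_product_def generated_von_neumann_algebra_def tensor_ops_def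
  using slot_bounded_ops by blast

lemma zero_in_M: "(\<lambda>_. 0) \<in> M"
  by (auto simp: von_neumann_tensor_product_def generated_von_neumann_algebra_def
      von_neumann_algebra_def star_algebra_def)

lemma ex_vacuum_slot_ops:
  "\<exists>X. \<forall>i. is_tensor_op J (slot i (\<phi> i)) (X i)"
proof -
  have "\<exists>X. is_tensor_op J (slot i (\<phi> i)) X" for i using ex_slot_op[OF unit] by blast
  then show ?thesis by (intro choice allI)
qed

text \<open>An operator in the commutant of \<open>N\<close> commutes with each finite product of
  slot projections, hence with their strong limit. So the limit lies in the bicommutant, which is
  \<open>N\<close>.\<close>

lemma vacuum_projection_in_M: "rank_one vacuum \<in> M"
  unfolding von_neumann_tensor_product_def generated_von_neumann_algebra_def
proof (rule InterI, clarify)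
  fix N assume N: "von_neumann_algebra N" "tensor_ops J (\<lambda>_. bounded_ops) \<subseteq> N"
  obtain X where X: "\<And>i. is_tensor_op J (slot i (\<phi> i)) (X i)"
    using ex_vacuum_slot_ops by blast
  then have XN: "X i \<in> N" for i
    using N(2) slot_bounded_ops unfolding tensor_ops_def by blast
  define P where "P = rec_nat id (\<lambda>n p. X n \<circ> p)"
  have P: "P 0 = id" "P (Suc n) = X n \<circ> P n" for n by (simp_all add: P_def)
  note lim = slot_projections_tendsto_vacuum[of X P, OF X P]
  have "rank_one vacuum \<in> commutant (commutant N)"
    unfolding commutant_def[of "commutant N"]
  proof (intro CollectI conjI ballI)
    fix S assume S: "S \<in> commutant N"
    then have Sb: "bounded_linear S" by (simp add: commutant_def bounded_ops_def)
    have SX: "S (X n x) = X n (S x)" for n x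
      using S XN[of n] by (auto simp: commutant_def fun_eq_iff)
    have SP: "S (P n x) = P n (S x)" for n x
      by (induction n) (simp_all add: P SX)
    have "rank_one vacuum (S x) = S (rank_one vacuum x)" for x
    proof (rule LIMSEQ_unique)
      show "(\<lambda>n. P n (S x)) \<longlonglongrightarrow> rank_one vacuum (S x)" by (rule lim)
      show "(\<lambda>n. P n (S x)) \<longlonglongrightarrow> S (rank_one vacuum x)"
        unfolding SP[symmetric] by (rule bounded_linear.tendsto[OF Sb lim])
    qed
    then show "rank_one vacuum \<circ> S = S \<circ> rank_one vacuum" by auto
  qed (rule rank_one_bounded_ops)
  then show "rank_one vacuum \<in> N" using N(1) by (simp add: von_neumann_algebra_def)
qed

section \<open>Asymptotics of slot projections and the effect of automorphisms\<close>

lemma slot_op_vacuum: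
  assumes "is_tensor_op J (slot i (\<phi> i)) X"
  shows "X vacuum = vacuum"
proof -
  have "rank_one (\<phi> i) (\<phi> i) = \<phi> i"
    by (simp add: rank_one_def cinner_self unit scaleC_one)
  then show ?thesis
    using slot_op_E[OF assms, of "Suc i" \<phi>] unfolding vacuum_eq[of "Suc i"] by simp
qed

text \<open>Beyond the levels of two elementary tensors both have \<open>\<phi> i\<close> as their
  \<open>i\<close>-th factor, so \<open>Y i\<close> contributes exactly the squared overlap as a
  scalar. The bound on \<open>d\<close> carries this over to arbitrary vectors.\<close>

lemma slot_op_overlap_tendsto_0:
  assumes w: "\<And>i. norm (w i) = 1" and Y: "\<And>i. is_tensor_op J (slot i (w i)) (Y i)"
  shows "(\<lambda>i. cmod (cinner (Y i x) y -
      complex_of_real ((cmod (cinner (\<phi> i) (w i)))\<^sup>2) * cinner x y)) \<longlonglongrightarrow> 0"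
proof -
  define c where "c i = complex_of_real ((cmod (cinner (\<phi> i) (w i)))\<^sup>2)" for i
  have c: "cmod (c i) \<le> 1" for i
    using power_mono[OF cmod_cinner_le[of "\<phi> i" "w i"], of 2] by (simp add: c_def w unit norm_power)
  define d where "d i x y = cmod (cinner (Y i x) y - c i * cinner x y)" for i x y
  have Yb: "Y i (x + y) = Y i x + Y i y" "Y i (a *\<^sub>C x) = a *\<^sub>C Y i x" for i x y a
    using Y[of i] by (auto simp: is_tensor_op_def bounded_ops_def linear_simps)
  have bound: "d i x y \<le> 2 * norm x * norm y" for i x y
  proof -
    have "cmod (cinner (Y i x) y) \<le> norm x * norm y"
      using cmod_cinner_le[of "Y i x" y] mult_right_mono[OF slot_op_contraction[OF w Y, of i x], of "norm y"]
      by simp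
    moreover have "cmod (c i * cinner x y) \<le> norm x * norm y"
      using mult_mono[OF c[of i] cmod_cinner_le[of x y]] by (simp add: norm_mult)
    ultimately show ?thesis
      using norm_triangle_ineq4[of "cinner (Y i x) y" "c i * cinner x y"] by (simp add: d_def)
  qed
  have add1: "d i (x + x') y \<le> d i x y + d i x' y" for i x x' y
    using norm_triangle_ineq[of "cinner (Y i x) y - c i * cinner x y" "cinner (Y i x') y - c i * cinner x' y"]
    by (simp add: d_def Yb cinner_add_left algebra_simps)
  have add2: "d i x (y + y') \<le> d i x y + d i x y'" for i x y y'
    using norm_triangle_ineq[of "cinner (Y i x) y - c i * cinner x y" "cinner (Y i x) y' - c i * cinner x y'"]
    by (simp add: d_def cinner_add_right algebra_simps)
  have scale1: "d i (a *\<^sub>C x) y = cmod a * d i x y" for i a x y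
  proof -
    have "d i (a *\<^sub>C x) y = cmod (a * (cinner (Y i x) y - c i * cinner x y))"
      by (simp add: d_def Yb cinner_scaleC_left algebra_simps)
    then show ?thesis by (simp only: norm_mult d_def)
  qed
  have scale2: "d i x (a *\<^sub>C y) = cmod a * d i x y" for i a x y
  proof -
    have "d i x (a *\<^sub>C y) = cmod (cnj a * (cinner (Y i x) y - c i * cinner x y))"
      by (simp add: d_def cinner_scaleC_right algebra_simps)
    then show ?thesis by (simp only: norm_mult complex_mod_cnj d_def)
  qed
  have EE: "(\<lambda>i. d i (E n \<xi>) (E m \<zeta>)) \<longlonglongrightarrow> 0" for n \<xi> m \<zeta>
  proof (rule tendsto_eventually, rule eventually_sequentiallyI)
    fix i assume i: "max n m \<le> i"
    let ?x = "pad n \<xi>" and ?y = "pad m \<zeta>"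
    have xy: "?x i = \<phi> i" "?y i = \<phi> i" using i by (simp_all add: pad_def)
    have E: "E n \<xi> = E (Suc i) ?x" "E m \<zeta> = E (Suc i) ?y" using i by (auto intro: E_pad)
    have "cinner (Y i (E (Suc i) ?x)) (E (Suc i) ?y) =
        (\<Prod>j<i. cinner (?x j) (?y j)) * (cinner (\<phi> i) (w i) * cinner (w i) (\<phi> i))"
      unfolding slot_op_E[OF Y lessI] E_cinner by (simp add: xy rank_one_def cinner_scaleC_left)
    also have "cinner (\<phi> i) (w i) * cinner (w i) (\<phi> i) = c i"
      unfolding c_def complex_norm_square using cinner_commute[of "w i" "\<phi> i"] by simp
    \<comment> \<open>The missing factor at position \<open>i\<close> is the inner product of
      \<open>\<phi> i\<close> with itself, which is 1.\<close>
    also have "(\<Prod>j<i. cinner (?x j) (?y j)) = cinner (E (Suc i) ?x) (E (Suc i) ?y)"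
      by (simp add: E_cinner xy cinner_self unit)
    finally show "d i (E n \<xi>) (E m \<zeta>) = 0" unfolding E d_def by (simp add: mult.commute)
  qed
  \<comment> \<open>The extension takes two passes: first the second argument becomes arbitrary,
    then the first.\<close>
  have Ey: "(\<lambda>i. d i (E n \<xi>) y) \<longlonglongrightarrow> 0" for n \<xi> y
    by (rule seminorms_tendsto_0[where p = "\<lambda>i. d i (E n \<xi>)" and C = "2 * norm (E n \<xi>)"])
       (simp_all add: add2 scale2 bound EE, simp add: d_def)
  have "(\<lambda>i. d i x y) \<longlonglongrightarrow> 0"
    by (rule seminorms_tendsto_0[where p = "\<lambda>i x. d i x y" and C = "2 * norm y"])
       (use bound[of _ _ y] in \<open>simp_all add: add1 scale1 Ey mult_ac\<close>, simp add: d_def)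
  then show ?thesis by (simp only: d_def c_def)
qed

text \<open>The image under \<open>\<theta>\<close> of the projection onto the vacuum is a non-zero projection below all the
  images of slot projections, so a vector \<open>\<eta>\<close> in its range is fixed by each of the latter.\<close>

lemma automorphism_overlap_tendsto_1:
  assumes \<theta>: "star_automorphism M \<theta>" and w: "\<And>i. norm (w i) = 1"
    and \<theta>_slot: "\<And>i X. is_tensor_op J (slot i (\<phi> i)) X \<Longrightarrow> is_tensor_op J (slot i (w i)) (\<theta> X)"
  shows "(\<lambda>i. cmod (cinner (\<phi> i) (w i))) \<longlonglongrightarrow> 1"
proof -
  define Q where "Q = rank_one vacuum"
  have QM: "Q \<in> M" unfolding Q_def by (rule vacuum_projection_in_M)
  obtain X where X: "\<And>i. is_tensor_op J (slot i (\<phi> i)) (X i)"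
    using ex_vacuum_slot_ops by blast
  have XQ: "X i \<circ> Q = Q" for i
  proof
    fix x
    have "X i (c *\<^sub>C vacuum) = c *\<^sub>C vacuum" for c
      using X[of i] slot_op_vacuum[OF X] by (simp add: is_tensor_op_def bounded_ops_def)
    then show "(X i \<circ> Q) x = Q x" by (simp add: Q_def rank_one_def)
  qed
  have mult: "\<theta> (S \<circ> T) = \<theta> S \<circ> \<theta> T" and add: "\<theta> (\<lambda>x. S x + T x) = (\<lambda>x. \<theta> S x + \<theta> T x)"
    if "S \<in> M" "T \<in> M" for S T
    using \<theta> that by (auto simp: star_automorphism_def)
  have \<theta>0: "\<theta> (\<lambda>_. 0) = (\<lambda>_. 0)"
    using add[OF zero_in_M zero_in_M] by (simp add: fun_eq_iff)
  have "Q vacuum = vacuum" by (simp add: Q_def rank_one_def cinner_self norm_vacuum scaleC_one)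
  then have "Q \<noteq> (\<lambda>_. 0)" using norm_vacuum by auto
  \<comment> \<open>By additivity \<theta> fixes 0, so injectivity on \<open>M\<close> keeps the
    image of \<open>Q\<close> away from 0.\<close>
  then have "\<theta> Q \<noteq> (\<lambda>_. 0)"
    using \<theta>0 inj_onD[of \<theta> M Q "\<lambda>_. 0"] \<theta> QM zero_in_M
    by (auto simp: star_automorphism_def bij_betw_def)
  then obtain x where x: "\<theta> Q x \<noteq> 0" by auto
  define \<eta> where "\<eta> = \<theta> Q x"
  have fixed: "\<theta> (X i) \<eta> = \<eta>" for i
    using mult[OF tensor_op_in_M[OF X] QM, of i] by (simp add: XQ \<eta>_def fun_eq_iff)
  define r where "r i = cmod (cinner (\<phi> i) (w i))" for i
  have r: "0 \<le> r i" "r i \<le> 1" for i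
    using cmod_cinner_le[of "\<phi> i" "w i"] by (simp_all add: r_def w unit)
  \<comment> \<open>As \<eta> is fixed, the deviation from the scalar is exactly this multiple of
    the nonzero number \<open>(norm \<eta>)\<^sup>2\<close>; its convergence to 0 forces the squared
    overlaps to 1.\<close>
  have "cmod (cinner (\<theta> (X i) \<eta>) \<eta> - complex_of_real ((r i)\<^sup>2) * cinner \<eta> \<eta>) = (1 - (r i)\<^sup>2) * (norm \<eta>)\<^sup>2" for i
  proof -
    have "cinner (\<theta> (X i) \<eta>) \<eta> - complex_of_real ((r i)\<^sup>2) * cinner \<eta> \<eta>
        = complex_of_real ((1 - (r i)\<^sup>2) * (norm \<eta>)\<^sup>2)"
      unfolding fixed cinner_self by (simp add: algebra_simps)
    moreover have "0 \<le> (1 - (r i)\<^sup>2) * (norm \<eta>)\<^sup>2"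
      using power_le_one[OF r(1,2), of i 2] by simp
    ultimately show ?thesis by (simp only: norm_of_real abs_of_nonneg)
  qed
  then have "(\<lambda>i. (1 - (r i)\<^sup>2) * (norm \<eta>)\<^sup>2) \<longlonglongrightarrow> 0"
    using slot_op_overlap_tendsto_0[OF w \<theta>_slot[OF X], of \<eta> \<eta>] by (simp only: r_def)
  then have "(\<lambda>i. (1 - (r i)\<^sup>2) * (norm \<eta>)\<^sup>2 / (norm \<eta>)\<^sup>2) \<longlonglongrightarrow> 0"
    by (rule tendsto_divide_zero)
  then have "(\<lambda>i. 1 - (r i)\<^sup>2) \<longlonglongrightarrow> 0" using x by (simp add: \<eta>_def)
  from tendsto_diff[OF tendsto_const[of 1] this] have "(\<lambda>i. (r i)\<^sup>2) \<longlonglongrightarrow> 1" by simp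
  then have "r \<longlonglongrightarrow> 1"
  proof (rule tendsto_sandwich[OF _ _ _ tendsto_const, rotated 2])
    show "\<forall>\<^sub>F i in sequentially. (r i)\<^sup>2 \<le> r i"
      using r by (simp add: power2_eq_square mult_left_le)
    show "\<forall>\<^sub>F i in sequentially. r i \<le> 1" using r by simp
  qed
  then show ?thesis by (simp add: r_def[abs_def])
qed

end

section \<open>Projective regular representations\<close>

text \<open>The definite description is legitimate: the difference of two candidate values is
  orthogonal to every vector, itself included.\<close>

lemma cadjoint_eqI:
  assumes "\<And>x y. cinner (T x) y = cinner x (S y)"
  shows "cadjoint T = S"
  unfolding cadjoint_def
proof (rule the_equality)
  fix S' assume S': "\<forall>x y. cinner (T x) y = cinner x (S' y)"
  show "S' = S"
  proof
    fix y
    have "cinner (S' y - S y) (S' y - S y) = 0"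
      using S' assms by (metis cinner_diff_right right_minus_eq)
    then show "S' y = S y" by (simp add: cinner_self)
  qed
qed (simp add: assms)

lemma bij_translation: "bij (\<lambda>y :: 'g::group_add. - x + y)"
  by (rule bij_betwI[where g = "\<lambda>y. x + y"]) (auto simp flip: add.assoc)

text \<open>The unimodular phases cancel and the translation merely reindexes the sum.\<close>

lemma cinner_regular_rep:
  assumes u: "u \<in> cocycles"
  shows "cinner (regular_rep u x f) (regular_rep u x h) = cinner f h"
proof -
  have "u (- y) x * cnj (u (- y) x) = 1" for y
    using u complex_norm_square[of "u (- y) x"] by (simp add: cocycles_def)
  then have "u (- y) x * a * cnj (u (- y) x * b) = a * cnj b" for y a b
    by (metis complex_cnj_mult mult.assoc mult.left_commute mult_1)
  then have "((\<lambda>y. Rep_ell2 f (- x + y) * cnj (Rep_ell2 h (- x + y)))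
      has_sum cinner (regular_rep u x f) (regular_rep u x h)) UNIV"
    using cinner_ell2_has_sum[of "regular_rep u x f" "regular_rep u x h"]
    by (simp only: Rep_regular_rep[OF u])
  moreover have "((\<lambda>y. Rep_ell2 f (- x + y) * cnj (Rep_ell2 h (- x + y))) has_sum cinner f h) UNIV"
    using has_sum_reindex_bij_betw[OF bij_translation[of x], where f = "\<lambda>y. Rep_ell2 f y * cnj (Rep_ell2 h y)"]
      cinner_ell2_has_sum[of f h] by simp
  ultimately show ?thesis by (rule has_sum_unique)
qed

lemma norm_regular_rep: "u \<in> cocycles \<Longrightarrow> norm (regular_rep u x f) = norm f"
  using cinner_regular_rep[of u x f f] by (simp add: norm_eq_sqrt_inner inner_Re_cinner)

lemma regular_rep_scaleC:
  "u \<in> cocycles \<Longrightarrow> regular_rep u x (c *\<^sub>C f) = c *\<^sub>C regular_rep u x f"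
  by (intro Rep_ell2_inject[THEN iffD1]) (simp add: fun_eq_iff Rep_regular_rep scaleC_ell2.rep_eq)

text \<open>An isometry V with a right inverse S satisfies <V f, h> = <V f, V S h> = <f, S h>, so S
  is its adjoint.\<close>

lemma cadjoint_regular_rep:
  assumes u: "u \<in> cocycles"
  shows "regular_rep u x (cadjoint (regular_rep u x) f) = f"
    and "cinner (cadjoint (regular_rep u x) f) h = cinner f (regular_rep u x h)"
proof -
  \<comment> \<open>Undo the translation, and conjugate the phase at the translated point so that it
    cancels.\<close>
  define S where "S f = Abs_ell2 (\<lambda>y. cnj (u (- (x + y)) x) * Rep_ell2 f (x + y))" for f
  have "(\<lambda>y. (cmod (cnj (u (- (x + y)) x) * Rep_ell2 f (x + y)))\<^sup>2) summable_on UNIV" for f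
    using u Rep_ell2_summable[of f] bij_translation[of "- x"]
      summable_on_reindex_bij_betw[of "\<lambda>y. x + y" UNIV UNIV "\<lambda>y. (cmod (Rep_ell2 f y))\<^sup>2"]
    by (simp add: norm_mult cocycles_def)
  then have RS: "Rep_ell2 (S f) = (\<lambda>y. cnj (u (- (x + y)) x) * Rep_ell2 f (x + y))" for f
    unfolding S_def by (rule Rep_Abs_ell2)
  have "u (- y) x * cnj (u (- y) x) = 1" for y
    using u complex_norm_square[of "u (- y) x"] by (simp add: cocycles_def)
  then have VS: "regular_rep u x (S f) = f" for f
    by (intro Rep_ell2_inject[THEN iffD1])
       (simp add: fun_eq_iff Rep_regular_rep[OF u] RS flip: add.assoc mult.assoc)
  have adj: "cinner (regular_rep u x f) h = cinner f (S h)" for f h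
    using cinner_regular_rep[OF u, of x f "S h"] by (simp add: VS)
  have S: "cadjoint (regular_rep u x) = S"
    by (rule cadjoint_eqI) (rule adj)
  show "regular_rep u x (cadjoint (regular_rep u x) f) = f" unfolding S by (rule VS)
  show "cinner (cadjoint (regular_rep u x) f) h = cinner f (regular_rep u x h)"
    unfolding S using adj cinner_commute by metis
qed

text \<open>Conjugating |v><v| by a unitary V gives |Vv><Vv|, and conjugating the identity gives the
  identity.\<close>

lemma Ad_regular_rep_slot:
  assumes "u \<in> cocycles"
  shows "Ad (regular_rep u x) (slot i v i) = slot i (regular_rep u x v) i"
    and "i \<noteq> j \<Longrightarrow> Ad (regular_rep u x) (slot i v j) = id"
  by (auto simp: fun_eq_iff Ad_def slot_def rank_one_def cadjoint_regular_rep[OF assms]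
      regular_rep_scaleC[OF assms])

section \<open>Uncountable and non-amenable groups\<close>

lemma countable_ell2_support: "countable {x. Rep_ell2 f x \<noteq> 0}"
  using summable_countable_real[OF Rep_ell2_summable[of f]] by simp

lemma uncountable_ex_regular_rep_orthogonal:
  fixes \<phi> :: "nat \<Rightarrow> 'g::group_add ell2"
  assumes "uncountable (UNIV :: 'g set)" and u: "\<And>i. u i \<in> cocycles"
  obtains g where "\<And>i. cinner (\<phi> i) (regular_rep (u i) g (\<phi> i)) = 0"
proof -
  define C where "C = (\<Union>i. {x. Rep_ell2 (\<phi> i) x \<noteq> 0})"
  have "countable C" unfolding C_def by (intro countable_UN countable_ell2_support) simp
  \<comment> \<open>If \<open>g\<close> is no difference of two points of \<open>C\<close>, then
    \<open>y\<close> and \<open>- g + y\<close> never both lie in \<open>C\<close>. Since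
    \<open>C\<close> collects all supports, one \<open>g\<close> serves every
    \<open>i\<close>.\<close>
  then have "countable ((\<lambda>(a, b). a - b) ` (C \<times> C))" by auto
  then obtain g where g: "g \<notin> (\<lambda>(a, b). a - b) ` (C \<times> C)"
    using assms(1) by (metis UNIV_eq_I)
  have "cinner (\<phi> i) (regular_rep (u i) g (\<phi> i)) = 0" for i
  proof -
    have "Rep_ell2 (\<phi> i) y * cnj (Rep_ell2 (regular_rep (u i) g (\<phi> i)) y) = 0" for y
    proof (rule ccontr)
      assume "\<not> ?thesis"
      then have "y \<in> C" "- g + y \<in> C" by (auto simp: Rep_regular_rep[OF u] C_def)
      moreover have "g = y - (- g + y)" by (simp add: diff_conv_add_uminus minus_add)
      ultimately show False using g by force
    qed
    then show ?thesis
      unfolding cinner_ell2.rep_eq by (intro infsum_0) simp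
  qed
  then show ?thesis using that by blast
qed

text \<open>Tychonoff: the functionals lie in a product of compact intervals. The product may be
  over an uncountable index set, so the limit is taken along a filter finer than
  \<open>sequentially\<close> instead of a subsequence.\<close>

lemma ex_cluster_functional:
  fixes m :: "nat \<Rightarrow> 'a \<Rightarrow> real"
  assumes B: "\<And>i f. \<bar>m i f\<bar> \<le> B f"
  shows "\<exists>G L. G \<noteq> bot \<and> G \<le> sequentially \<and> (\<forall>f. ((\<lambda>i. m i f) \<longlongrightarrow> L f) G)"
proof -
  define K where "K = PiE UNIV (\<lambda>f. {- B f..B f})"
  have "compactin (product_topology (\<lambda>_. euclidean) UNIV) K"
    unfolding K_def by (subst compactin_PiE) simp
  then have "compact K" by (simp add: euclidean_product_topology)
  moreover have "m i \<in> K" for i using B[of i] by (auto simp: K_def abs_le_iff minus_le_iff)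
  then have "eventually (\<lambda>x. x \<in> K) (filtermap m sequentially)" by (simp add: eventually_filtermap)
  moreover have "filtermap m sequentially \<noteq> bot" by (simp add: filtermap_bot_iff)
  ultimately obtain L where L: "inf (nhds L) (filtermap m sequentially) \<noteq> bot"
    unfolding compact_filter by blast
  \<comment> \<open>Indices that are large and whose functional is near \<open>L\<close>; this
    filter is proper because \<open>L\<close> is a cluster point.\<close>
  define G where "G = inf (filtercomap m (nhds L)) sequentially"
  have "G \<noteq> bot"
  proof
    assume "G = bot"
    then have "eventually (\<lambda>_. False) G" by simp
    then obtain P Q where P: "eventually P (nhds L)" and Q: "eventually Q sequentially"
      and PQ: "\<And>i. P (m i) \<Longrightarrow> Q i \<Longrightarrow> False"
      unfolding G_def eventually_inf eventually_filtercomap by blast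
    have "eventually (\<lambda>y. \<exists>i. y = m i \<and> Q i) (filtermap m sequentially)"
      unfolding eventually_filtermap using Q by (rule eventually_mono) blast
    then have "eventually (\<lambda>_. False) (inf (nhds L) (filtermap m sequentially))"
      using P PQ unfolding eventually_inf by blast
    then show False using L by (simp add: trivial_limit_def)
  qed
  moreover have "((\<lambda>i. m i f) \<longlongrightarrow> L f) G" for f
  proof -
    have "(m \<longlongrightarrow> L) G"
      unfolding G_def by (rule filterlim_mono[OF filterlim_filtercomap order_refl inf_le1])
    then show ?thesis
      by (rule continuous_on_tendsto_compose[OF continuous_on_product_coordinates]) auto
  qed
  moreover have "G \<le> sequentially" unfolding G_def by (rule inf_le2)
  ultimately show ?thesis by blast
qed

section \<open>Multiplication operators, vector states and invariant means\<close>

definition ell2_mult :: "('a \<Rightarrow> real) \<Rightarrow> 'a ell2 \<Rightarrow> 'a ell2" where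
  "ell2_mult f \<psi> = Abs_ell2 (\<lambda>x. complex_of_real (f x) * Rep_ell2 \<psi> x)"

text \<open>Boundedness keeps the product square-summable, so that \<open>Abs_ell2\<close> is
  applied inside its domain.\<close>

lemma Rep_ell2_mult:
  assumes "bounded (range f)"
  shows "Rep_ell2 (ell2_mult f \<psi>) = (\<lambda>x. complex_of_real (f x) * Rep_ell2 \<psi> x)"
proof -
  obtain B where B: "\<And>x. \<bar>f x\<bar> \<le> B" using assms by (auto simp: bounded_iff)
  have "(\<lambda>x. (cmod (complex_of_real (f x) * Rep_ell2 \<psi> x))\<^sup>2) summable_on UNIV"
  proof (rule summable_on_comparison_test)
    show "(\<lambda>x. B\<^sup>2 * (cmod (Rep_ell2 \<psi> x))\<^sup>2) summable_on UNIV"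
      by (intro summable_on_cmult_right Rep_ell2_summable)
    show "(cmod (complex_of_real (f x) * Rep_ell2 \<psi> x))\<^sup>2 \<le> B\<^sup>2 * (cmod (Rep_ell2 \<psi> x))\<^sup>2" for x
      using power_mono[OF B[of x], of 2]
      by (simp add: norm_mult power_mult_distrib mult_right_mono)
  qed auto
  then show ?thesis unfolding ell2_mult_def by (rule Rep_Abs_ell2)
qed

lemma norm_ell2_mult_le:
  assumes "\<And>x. \<bar>f x\<bar> \<le> B"
  shows "norm (ell2_mult f \<psi>) \<le> B * norm \<psi>"
proof (rule norm_ell2_le)
  have B: "0 \<le> B" using assms[of undefined] by linarith
  then show "0 \<le> B * norm \<psi>" by simp
  have f: "bounded (range f)" using assms by (auto simp: bounded_iff)
  fix F :: "'a set" assume F: "finite F"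
  have "(\<Sum>i\<in>F. (cmod (Rep_ell2 (ell2_mult f \<psi>) i))\<^sup>2) \<le> (\<Sum>i\<in>F. B\<^sup>2 * (cmod (Rep_ell2 \<psi> i))\<^sup>2)"
    using power_mono[OF assms, where n = 2]
    by (intro sum_mono) (simp add: Rep_ell2_mult[OF f] norm_mult power_mult_distrib mult_right_mono)
  also have "\<dots> \<le> (B * norm \<psi>)\<^sup>2"
    using mult_left_mono[OF sum_le_norm_ell2[OF F, of \<psi>], of "B\<^sup>2"]
    by (simp add: power_mult_distrib sum_distrib_left)
  finally show "(\<Sum>i\<in>F. (cmod (Rep_ell2 (ell2_mult f \<psi>) i))\<^sup>2) \<le> (B * norm \<psi>)\<^sup>2" .
qed

lemma ell2_mult_linear:
  assumes "bounded (range f)"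
  shows "ell2_mult f (x + y) = ell2_mult f x + ell2_mult f y"
    and "ell2_mult f (c *\<^sub>C x) = c *\<^sub>C ell2_mult f x"
  by (intro Rep_ell2_inject[THEN iffD1];
      simp add: fun_eq_iff Rep_ell2_mult[OF assms] plus_ell2.rep_eq scaleC_ell2.rep_eq algebra_simps)+

text \<open>Covariance: phases commute with multiplication, so only the translation acts on
  \<open>f\<close>. This turns translation of functions into a change of the vector in a vector
  state.\<close>

lemma regular_rep_ell2_mult:
  assumes "u \<in> cocycles" "bounded (range f)"
  shows "regular_rep u g (ell2_mult f \<psi>) = ell2_mult (\<lambda>x. f (- g + x)) (regular_rep u g \<psi>)"
proof -
  have "bounded (range (\<lambda>x. f (- g + x)))" using assms(2) by (rule bounded_subset) auto
  then show ?thesis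
    by (intro Rep_ell2_inject[THEN iffD1])
       (simp add: fun_eq_iff Rep_regular_rep[OF assms(1)] Rep_ell2_mult assms(2))
qed

text \<open>Up to a phase, \<open>w\<close> is close to \<open>v\<close> when their overlap is close to \<open>1\<close>, and the phase does not
  affect the vector state.\<close>

lemma vector_state_overlap_bound:
  assumes f: "\<And>x. \<bar>f x\<bar> \<le> B" and v: "norm v = 1" and w: "norm w = 1"
  shows "cmod (cinner (ell2_mult f w) w - cinner (ell2_mult f v) v)
    \<le> 2 * B * sqrt (2 - 2 * cmod (cinner v w))"
proof -
  have bf: "bounded (range f)" using f by (auto simp: bounded_iff)
  have B: "0 \<le> B" using f[of undefined] by linarith
  define c where "c = cinner w v"
  \<comment> \<open>The phase of \<open>c\<close> makes the inner product of \<open>w\<close> with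
    \<open>\<omega> *\<^sub>C v\<close> equal to the modulus of \<open>c\<close>; the value 1 at
    \<open>c = 0\<close> keeps it unimodular.\<close>
  define \<omega> where "\<omega> = (if c = 0 then 1 else c / cmod c)"
  have \<omega>: "cmod \<omega> = 1" by (simp add: \<omega>_def norm_divide)
  then have \<omega>2: "\<omega> * cnj \<omega> = 1" by (simp flip: complex_norm_square)
  define v' where "v' = \<omega> *\<^sub>C v"
  have nv': "norm v' = 1" by (simp add: v'_def norm_scaleC \<omega> v)
  have state: "cinner (ell2_mult f v') v' = cinner (ell2_mult f v) v"
    using \<omega>2 by (simp add: v'_def ell2_mult_linear[OF bf] cinner_scaleC_left cinner_scaleC_right
        flip: mult.assoc) (simp add: mult.commute)
  have "cinner w v' = complex_of_real (cmod c)"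
    using complex_norm_square[of c]
    by (auto simp: v'_def cinner_scaleC_right \<omega>_def power2_eq_square field_simps simp flip: c_def)
  then have "inner w v' = cmod c" by (simp add: inner_Re_cinner)
  then have "(norm (w - v'))\<^sup>2 = 2 - 2 * cmod c"
    using nv' w dot_norm_neg[of w v'] by (simp add: field_simps)
  moreover have "cmod c = cmod (cinner v w)"
    unfolding c_def by (subst cinner_commute) simp
  ultimately have nd: "norm (w - v') = sqrt (2 - 2 * cmod (cinner v w))"
    by (metis norm_ge_zero real_sqrt_unique)
  define d where "d = w - v'"
  have wd: "w = v' + d" by (simp add: d_def)
  \<comment> \<open>Expanding along \<open>w = v' + d\<close> leaves two terms, each at most
    \<open>B * norm d\<close>.\<close>
  have "cinner (ell2_mult f w) w - cinner (ell2_mult f v') v'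
      = cinner (ell2_mult f w) d + cinner (ell2_mult f d) v'"
  proof -
    have "ell2_mult f w = ell2_mult f v' + ell2_mult f d" unfolding wd by (rule ell2_mult_linear[OF bf])
    then show ?thesis by (subst (2) wd) (simp add: cinner_add_left cinner_add_right)
  qed
  also have "cmod \<dots> \<le> B * norm d + B * norm d"
  proof (rule order_trans[OF norm_triangle_ineq], rule add_mono)
    have "cmod (cinner (ell2_mult f w) d) \<le> norm (ell2_mult f w) * norm d" by (rule cmod_cinner_le)
    also have "\<dots> \<le> (B * norm w) * norm d"
      by (intro mult_right_mono norm_ell2_mult_le f) simp
    finally show "cmod (cinner (ell2_mult f w) d) \<le> B * norm d" by (simp add: w)
    have "cmod (cinner (ell2_mult f d) v') \<le> norm (ell2_mult f d) * norm v'" by (rule cmod_cinner_le)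
    also have "\<dots> \<le> (B * norm d) * norm v'"
      by (intro mult_right_mono norm_ell2_mult_le f) simp
    finally show "cmod (cinner (ell2_mult f d) v') \<le> B * norm d" by (simp add: nv')
  qed
  finally show ?thesis by (simp add: state nd flip: d_def) (simp add: d_def nd)
qed

lemma amenable_if_asymptotically_invariant:
  fixes \<phi> :: "nat \<Rightarrow> 'g::group_add ell2"
  assumes u: "\<And>i. u i \<in> cocycles" and unit: "\<And>i. norm (\<phi> i) = 1"
    and lim: "\<And>g. (\<lambda>i. cmod (cinner (\<phi> i) (regular_rep (u i) g (\<phi> i)))) \<longlonglongrightarrow> 1"
  shows "amenable TYPE('g)"
proof -
  \<comment> \<open>The value 0 on unbounded functions keeps \<open>m i f\<close> bounded in
    \<open>i\<close> for every \<open>f\<close>, as the cluster point argument requires.\<close>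
  define m where "m i f = (if bounded (range f) then Re (cinner (ell2_mult f (\<phi> i)) (\<phi> i)) else 0)"
    for i and f :: "'g \<Rightarrow> real"
  have "\<exists>B. bounded (range f) \<longrightarrow> (\<forall>x. \<bar>f x\<bar> \<le> B)" for f :: "'g \<Rightarrow> real"
    by (auto simp: bounded_iff)
  then obtain B where B: "\<And>(f :: 'g \<Rightarrow> real) x. bounded (range f) \<Longrightarrow> \<bar>f x\<bar> \<le> B f"
    by metis
  have m_le: "\<bar>m i f\<bar> \<le> (if bounded (range f) then B f else 0)" for i f
  proof (cases "bounded (range f)")
    case True
    have "\<bar>m i f\<bar> \<le> cmod (cinner (ell2_mult f (\<phi> i)) (\<phi> i))"
      using True by (simp add: m_def abs_Re_le_cmod)
    also have "\<dots> \<le> B f"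
      using cmod_cinner_le[of "ell2_mult f (\<phi> i)" "\<phi> i"]
        norm_ell2_mult_le[of f "B f" "\<phi> i"] B[OF True] by (simp add: unit)
    finally show ?thesis using True by simp
  qed (simp add: m_def)
  obtain G L where G: "G \<noteq> bot" "G \<le> sequentially"
    and L: "\<And>f. ((\<lambda>i. m i f) \<longlongrightarrow> L f) G"
    using ex_cluster_functional[of m, OF m_le] by blast
  have badd: "bounded (range (\<lambda>x. f x + h x))" if "bounded (range f)" "bounded (range h)"
    for f h :: "'g \<Rightarrow> real"
    using that by (rule bounded_plus_comp)
  have bscale: "bounded (range (\<lambda>x. c * f x))" if "bounded (range f)" for f :: "'g \<Rightarrow> real" and c
    using bounded_scaling[OF that, of c] by (simp add: image_image)
  have "L (\<lambda>x. f x + h x) = L f + L h" if "bounded (range f)" "bounded (range h)" for f h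
  proof -
    have "ell2_mult (\<lambda>x. f x + h x) \<psi> = ell2_mult f \<psi> + ell2_mult h \<psi>" for \<psi>
      using that badd[OF that] by (intro Rep_ell2_inject[THEN iffD1])
        (simp add: fun_eq_iff Rep_ell2_mult plus_ell2.rep_eq algebra_simps)
    then have "m i (\<lambda>x. f x + h x) = m i f + m i h" for i
      using that badd[OF that] by (simp add: m_def cinner_add_left)
    then show ?thesis using tendsto_unique[OF G(1) L] tendsto_add[OF L L] by simp
  qed
  moreover have "L (\<lambda>x. c * f x) = c * L f" if "bounded (range f)" for c f
  proof -
    have "ell2_mult (\<lambda>x. c * f x) \<psi> = complex_of_real c *\<^sub>C ell2_mult f \<psi>" for \<psi>
      using that bscale[OF that] by (intro Rep_ell2_inject[THEN iffD1])
        (simp add: fun_eq_iff Rep_ell2_mult scaleC_ell2.rep_eq)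
    then have "m i (\<lambda>x. c * f x) = c * m i f" for i
      using that bscale[OF that] by (simp add: m_def cinner_scaleC_left)
    then show ?thesis using tendsto_unique[OF G(1) L] tendsto_mult_left[OF L] by simp
  qed
  moreover have "0 \<le> L f" if "bounded (range f)" "\<forall>x. 0 \<le> f x" for f
  proof (rule tendsto_lowerbound[OF L _ G(1)], rule always_eventually, rule allI)
    fix i
    have "((\<lambda>x. Re (complex_of_real (f x) * Rep_ell2 (\<phi> i) x * cnj (Rep_ell2 (\<phi> i) x)))
        has_sum Re (cinner (ell2_mult f (\<phi> i)) (\<phi> i))) UNIV"
      using has_sum_Re[OF cinner_ell2_has_sum[of "ell2_mult f (\<phi> i)" "\<phi> i"]]
      by (simp only: Rep_ell2_mult[OF that(1)])
    moreover have "0 \<le> Re (complex_of_real (f x) * Rep_ell2 (\<phi> i) x * cnj (Rep_ell2 (\<phi> i) x))" for x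
      using that(2) by (simp add: mult.assoc flip: complex_norm_square)
    ultimately show "0 \<le> m i f" using that(1) by (simp add: m_def has_sum_nonneg)
  qed
  moreover have "L (\<lambda>_. 1) = 1"
  proof -
    have "ell2_mult (\<lambda>_. 1) \<psi> = \<psi>" for \<psi> :: "'g ell2"
      by (intro Rep_ell2_inject[THEN iffD1]) (simp add: Rep_ell2_mult)
    then have "m i (\<lambda>_. 1) = 1" for i by (simp add: m_def cinner_self unit)
    then show ?thesis using tendsto_unique[OF G(1) L[of "\<lambda>_. 1"]] by simp
  qed
  moreover have "L (\<lambda>x. f (- g + x)) = L f" if f: "bounded (range f)" for g f
  proof -
    let ?f = "\<lambda>x. f (- g + x)"
    have bf: "bounded (range ?f)" using f by (rule bounded_subset) auto
    have "(\<lambda>i. m i f - m i ?f) \<longlonglongrightarrow> 0"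
    proof (rule Lim_null_comparison)
      show "(\<lambda>i. 2 * B f * sqrt (2 - 2 * cmod (cinner (\<phi> i) (regular_rep (u i) g (\<phi> i))))) \<longlonglongrightarrow> 0"
        by (rule tendsto_eq_intros refl lim | simp)+
      show "\<forall>\<^sub>F i in sequentially. norm (m i f - m i ?f) \<le>
          2 * B f * sqrt (2 - 2 * cmod (cinner (\<phi> i) (regular_rep (u i) g (\<phi> i))))"
      proof (rule always_eventually, rule allI)
        fix i
        let ?w = "regular_rep (u i) g (\<phi> i)"
        \<comment> \<open>Covariance and isometry rewrite \<open>m i f\<close> as the state of the
          translated function at \<open>?w\<close>, so the same function is compared at the two
          vectors \<open>?w\<close> and \<open>\<phi> i\<close>.\<close>
        have "cinner (ell2_mult ?f ?w) ?w = cinner (ell2_mult f (\<phi> i)) (\<phi> i)"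
          by (simp add: cinner_regular_rep[OF u] flip: regular_rep_ell2_mult[OF u f])
        then have "norm (m i f - m i ?f) \<le>
            cmod (cinner (ell2_mult ?f ?w) ?w - cinner (ell2_mult ?f (\<phi> i)) (\<phi> i))"
          using f bf abs_Re_le_cmod[of "cinner (ell2_mult f (\<phi> i)) (\<phi> i) - cinner (ell2_mult ?f (\<phi> i)) (\<phi> i)"]
          by (simp add: m_def)
        also have "\<dots> \<le> 2 * B f * sqrt (2 - 2 * cmod (cinner (\<phi> i) ?w))"
          by (rule vector_state_overlap_bound) (simp_all add: B f unit norm_regular_rep u)
        finally show "norm (m i f - m i ?f) \<le> 2 * B f * sqrt (2 - 2 * cmod (cinner (\<phi> i) ?w))" .
      qed
    qed
    then have "((\<lambda>i. m i f - m i ?f) \<longlongrightarrow> 0) G" by (rule tendsto_mono[OF G(2)])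
    moreover have "((\<lambda>i. m i f - m i ?f) \<longlongrightarrow> L f - L ?f) G" by (intro tendsto_diff L)
    ultimately show ?thesis using tendsto_unique[OF G(1)] by fastforce
  qed
  ultimately show ?thesis unfolding amenable_def by blast
qed

theorem theorem5p5:
  fixes u :: "nat \<Rightarrow> 'g::group_add \<Rightarrow> 'g \<Rightarrow> complex"
    and \<phi> :: "nat \<Rightarrow> 'g ell2"
    and J :: "nat \<Rightarrow> 'g list ell2 \<Rightarrow> 'k::complex_hilbert"
  assumes "\<exists>x::'g. x \<noteq> 0"
    and "\<And>i. u i \<in> cocycles"
    and "uncountable (UNIV :: 'g set) \<or> \<not> amenable TYPE('g)"
    and "\<And>i. norm (\<phi> i) = 1"
    and "infinite_tensor_product \<phi> J"
  shows "\<not> (\<exists>\<beta> :: 'g \<Rightarrow> ('k \<Rightarrow> 'k) \<Rightarrow> ('k \<Rightarrow> 'k).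
      group_action (von_neumann_tensor_product J (\<lambda>_. bounded_ops)) \<beta> \<and>
      is_product_action J (\<lambda>_. bounded_ops) (\<lambda>i g. Ad (regular_rep (u i) g)) \<beta>)"
proof (rule notI, elim exE conjE)
  fix \<beta> :: "'g \<Rightarrow> ('k \<Rightarrow> 'k) \<Rightarrow> ('k \<Rightarrow> 'k)"
  assume act: "group_action (von_neumann_tensor_product J (\<lambda>_. bounded_ops)) \<beta>"
    and prod: "is_product_action J (\<lambda>_. bounded_ops) (\<lambda>i g. Ad (regular_rep (u i) g)) \<beta>"
  interpret infinite_tensor \<phi> J by unfold_locales fact+
  note u = assms(2) and unit = assms(4)
  have lim: "(\<lambda>i. cmod (cinner (\<phi> i) (regular_rep (u i) g (\<phi> i)))) \<longlonglongrightarrow> 1" for g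
  proof (rule automorphism_overlap_tendsto_1)
    show "star_automorphism M (\<beta> g)" using act by (simp add: group_action_def)
    show "norm (regular_rep (u i) g (\<phi> i)) = 1" for i by (simp add: norm_regular_rep u unit)
    fix i X assume X: "is_tensor_op J (slot i (\<phi> i)) X"
    \<comment> \<open>The product action turns a slot family into a slot family with translated
      vector, so its defining formula describes \<open>\<beta> g X\<close>.\<close>
    have "(\<lambda>j. Ad (regular_rep (u j) g) (slot i (\<phi> i) j)) = slot i (regular_rep (u i) g (\<phi> i))"
    proof
      show "Ad (regular_rep (u j) g) (slot i (\<phi> i) j) = slot i (regular_rep (u i) g (\<phi> i)) j" for j
        by (cases "i = j") (auto simp: Ad_regular_rep_slot u, simp add: slot_def)
    qed
    then show "is_tensor_op J (slot i (regular_rep (u i) g (\<phi> i))) (\<beta> g X)"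
      using prod X slot_bounded_ops unfolding is_product_action_def by metis
  qed
  show False
  proof (cases "uncountable (UNIV :: 'g set)")
    case True
    then obtain g where "\<And>i. cinner (\<phi> i) (regular_rep (u i) g (\<phi> i)) = 0"
      using uncountable_ex_regular_rep_orthogonal u by blast
    then show False using lim[of g] by (simp add: LIMSEQ_const_iff)
  next
    case False
    then show False
      using assms(3) amenable_if_asymptotically_invariant[OF u unit lim] by simp
  qed
qed

end
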